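(* Let $\mathcal S$ be a $T_4$ space, and let $\mu$ be a content on $\mathfrak R(\mathcal S)$. There is a unique normal probability charge $\nu$ on $\mathfrak A(\mathcal S)$ such that $$\fint_{\mathcal S}f\,d\mu=\int_{\mathcal S}f\,d\nu\qquad\text{for all } f\in\mathcal C_b(\mathcal S,\mathbb R).$$ Furthermore, there is a unique normal liminal charge structure $\{\rho_R\}_{R\in\mathfrak R(\mathcal S)}$ subordinate to $\nu$, such that for every $R\in\mathfrak R(\mathcal S)$, $$\mu[R]=\nu(R)+\rho_R(\partial R),$$ and also $$\fint_R f\,d\mu=\int_R f\,d\nu+\int_{\partial R}f\,d\rho_R\qquad\text{for all } f\in\mathcal C_b(\mathcal S,\mathbb R).$$
   Context: A $T_4$ space is a Hausdorff space in which any two disjoint closed sets have disjoint open neighbourhoods. $\mathcal C_b(\mathcal S,\mathbb R)$ is the space of bounded continuous real-valued functions on $\mathcal S$. $\partial R$ denotes the topological boundary of $R$. An open set $R\subseteq\mathcal S$ is regular if $R=\mathrm{int}(\mathrm{clos}(R))$. $\mathfrak R(\mathcal S)$ is the set of regular open subsets; it is a Boolean algebra with meet $\cap$, join $Q\vee R:=\mathrm{int}(\mathrm{clos}(Q\cup R))$ and complement $\neg R:=\mathrm{int}(\mathcal S\setminus R)$. A content on $\mathfrak R(\mathcal S)$ is a function $\mu:\mathfrak R(\mathcal S)\to[0,\infty)$ such that $\mu[R_1\vee\cdots\vee R_N]=\sum_n\mu[R_n]$ for every finite collection of disjoint regular open sets; by standing assumption $\mu[\mathcal S]=1$. A regular partition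 of $\mathcal S$ is a finite collection of disjoint elements of $\mathfrak R(\mathcal S)$ with join $\mathcal S$. Integral against a content: call $f:\mathcal S\to\mathbb R$ simple if it is constant on each cell of some regular partition of $\mathcal S$ (values off the cells are arbitrary). For $R\in\mathfrak R(\mathcal S)$ and bounded simple $f$ with value $r_n$ on the cell $P_n$, $\fint_R f\,d\mu:=\sum_n r_n\mu[P_n\cap R]$. Every $g\in\mathcal C_b(\mathcal S,\mathbb R)$ is a uniform limit of simple functions, and $\fint_R g\,d\mu$ is the supremum of $\fint_R f\,d\mu$ over all bounded simple $f$ with $f\le g$ on $R$. $\mathfrak A(\mathcal S)$ is the Boolean algebra of subsets of $\mathcal S$ generated by the open sets (under the usual set operations), and for $T\subseteq\mathcal S$, $\mathfrak A(T):=\{A\cap T: A\in\mathfrak A(\mathcal S)\}$. A charge on $\mathfrak A(T)$ is a finitely additive function $\nu:\mathfrak A(T)\to[0,1]$; it is a probability charge if $\nu[T]=1$. Integrals against charges are the usual integrals of bounded functions against finitely additive measures. A charge $\nu$ on $\mathfrak A(T)$ is normal if for all $B\in\mathfrak A(T)$, $\nu[B]=\sup\{\nu[C]: C\subseteq B,\ C\text{ closed in }T\}$ and $\nu[B]=\inf\{\nu[O]: B\subseteq O\subseteq T,\ O\text{ open in }T\}$. For $B\in\mathfrak A(\mathcal S)$, $\nu_B$ denotes the restriction of $\nu$ to $\mathfrak A(B)$. A liminal charge structure subordinate to a charge $\nu$ on $\mathfrak A(\mathcal S)$ is a collection $\{\rho_R\}_{R\in\mathfrak R(\mathcal S)}$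 where each $\rho_R$ is a charge on $\mathfrak A(\partial R)$, absolutely continuous with respect to $\nu$ ($\nu[U]=0$ implies $\rho_R[U]=0$), such that for every regular partition $\{R_1,\dots,R_N\}$ of $\mathcal S$, $\rho_{R_1}+\cdots+\rho_{R_N}=\nu_{\partial R_1\cup\cdots\cup\partial R_N}$, meaning $\sum_n\rho_{R_n}[U\cap\partial R_n]=\nu[U]$ for all $U\in\mathfrak A(\partial R_1\cup\cdots\cup\partial R_N)$. It is normal if each $\rho_R$ is a normal charge on $\partial R$. *)

theory Defs
  imports "HOL-Analysis.Analysis"
begin

text \<open>
  The ambient space is the whole type, so that the T4 property is the type class
  \<^class>\<open>t4_space\<close> (Hausdorff and normal). Set functions defined on a collection of sets
  are functions of type \<open>'a set \<Rightarrow> real\<close>. Charges and liminal charge structures are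
  \<^const>\<open>extensional\<close>, so that equality of two of them means equality on their domain.
\<close>

subsection \<open>Regular open sets and contents\<close>

definition regular_opens :: "'a::topological_space set set" where
  "regular_opens = {R. open R \<and> R = interior (closure R)}"

definition regular_join :: "'a::topological_space set \<Rightarrow> 'a set \<Rightarrow> 'a set" where
  "regular_join Q R = interior (closure (Q \<union> R))"

text \<open>
  The join of a finite family; the two lemmas show that it is the iterated binary join.
\<close>

definition regular_Join :: "'a::topological_space set set \<Rightarrow> 'a set" where
  "regular_Join F = interior (closure (\<Union>F))"

lemma regular_Join_empty: "regular_Join {} = {}"
  by (simp add: regular_Join_def)

lemma regular_Join_insert:
  assumes "F \<subseteq> regular_opens"
  shows "regular_Join (insert R F) = regular_join R (regular_Join F)"
proof -
  have "open (\<Union>F)"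
    using assms by (auto simp: regular_opens_def)
  then have "\<Union>F \<subseteq> interior (closure (\<Union>F))"
    using closure_subset interior_maximal by blast
  then have "closure (\<Union>F) = closure (interior (closure (\<Union>F)))"
    by (meson closure_closure closure_mono interior_subset order_antisym
        closure_minimal closed_closure)
  then show ?thesis
    by (simp add: regular_Join_def regular_join_def closure_Un)
qed

definition regular_content :: "('a::topological_space set \<Rightarrow> real) \<Rightarrow> bool" where
  "regular_content \<mu> \<longleftrightarrow>
     (\<forall>R\<in>regular_opens. 0 \<le> \<mu> R) \<and>
     (\<forall>F. finite F \<and> F \<subseteq> regular_opens \<and> disjoint F \<longrightarrow>
          \<mu> (regular_Join F) = (\<Sum>R\<in>F. \<mu> R)) \<and>
     \<mu> UNIV = 1"

definition regular_partition :: "'a::topological_space set set \<Rightarrow> bool" where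
  "regular_partition P \<longleftrightarrow>
     finite P \<and> P \<subseteq> regular_opens \<and> disjoint P \<and> regular_Join P = UNIV"

text \<open>
  A simple function is constant on the cells of a regular partition, with arbitrary values
  elsewhere; \<open>r\<close> lists the values on the cells.
\<close>

definition simple_with ::
    "'a::topological_space set set \<Rightarrow> ('a set \<Rightarrow> real) \<Rightarrow> ('a \<Rightarrow> real) \<Rightarrow> bool" where
  "simple_with P r f \<longleftrightarrow> regular_partition P \<and> (\<forall>p\<in>P. \<forall>x\<in>p. f x = r p)"

definition content_integral ::
    "'a::topological_space set \<Rightarrow> ('a set \<Rightarrow> real) \<Rightarrow> ('a \<Rightarrow> real) \<Rightarrow> real" where
  "content_integral R \<mu> g =
     Sup {(\<Sum>p\<in>P. r p * \<mu> (p \<inter> R)) |P r f.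
            simple_with P r f \<and> bounded (range f) \<and> (\<forall>x\<in>R. f x \<le> g x)}"

subsection \<open>Charges and their integrals\<close>

definition open_algebra :: "'a::topological_space set \<Rightarrow> 'a set set" where
  "open_algebra T = {A \<inter> T |A. A \<in> algebra UNIV hull {U. open U}}"

definition charge :: "'a::topological_space set \<Rightarrow> ('a set \<Rightarrow> real) \<Rightarrow> bool" where
  "charge T \<nu> \<longleftrightarrow> \<nu> \<in> open_algebra T \<rightarrow>\<^sub>E {0..1} \<and> additive (open_algebra T) \<nu>"

definition probability_charge :: "'a::topological_space set \<Rightarrow> ('a set \<Rightarrow> real) \<Rightarrow> bool" where
  "probability_charge T \<nu> \<longleftrightarrow> charge T \<nu> \<and> \<nu> T = 1"

definition normal_charge :: "'a::topological_space set \<Rightarrow> ('a set \<Rightarrow> real) \<Rightarrow> bool" where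
  "normal_charge T \<nu> \<longleftrightarrow> charge T \<nu> \<and>
     (\<forall>B\<in>open_algebra T.
        \<nu> B = Sup {\<nu> C |C. C \<subseteq> B \<and> closedin (top_of_set T) C} \<and>
        \<nu> B = Inf {\<nu> U |U. B \<subseteq> U \<and> openin (top_of_set T) U})"

definition charge_simple :: "'a::topological_space set \<Rightarrow> ('a \<Rightarrow> real) \<Rightarrow> bool" where
  "charge_simple T g \<longleftrightarrow> finite (g ` T) \<and> (\<forall>y\<in>g ` T. g -` {y} \<inter> T \<in> open_algebra T)"

definition charge_simple_integral ::
    "'a::topological_space set \<Rightarrow> ('a set \<Rightarrow> real) \<Rightarrow> ('a \<Rightarrow> real) \<Rightarrow> real" where
  "charge_simple_integral T \<nu> g = (\<Sum>y\<in>g ` T. y * \<nu> (g -` {y} \<inter> T))"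

text \<open>
  The usual integral of a bounded function against a finitely additive measure: lower and
  upper integrals over simple functions agree. Only the values of \<open>\<nu>\<close> on
  \<^term>\<open>open_algebra T\<close> enter, so for \<open>\<nu>\<close> a charge on the whole space and \<open>T\<close> in the algebra this
  is the integral over \<open>T\<close>, i.e. the integral against the restriction of \<open>\<nu>\<close> to
  \<^term>\<open>open_algebra T\<close>.
\<close>

definition has_charge_integral ::
    "'a::topological_space set \<Rightarrow> ('a set \<Rightarrow> real) \<Rightarrow> ('a \<Rightarrow> real) \<Rightarrow> real \<Rightarrow> bool" where
  "has_charge_integral T \<nu> f I \<longleftrightarrow> bounded (f ` T) \<and>
     Sup {charge_simple_integral T \<nu> g |g. charge_simple T g \<and> (\<forall>x\<in>T. g x \<le> f x)} = I \<and>
     Inf {charge_simple_integral T \<nu> g |g. charge_simple T g \<and> (\<forall>x\<in>T. f x \<le> g x)} = I"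

definition charge_integral ::
    "'a::topological_space set \<Rightarrow> ('a set \<Rightarrow> real) \<Rightarrow> ('a \<Rightarrow> real) \<Rightarrow> real" where
  "charge_integral T \<nu> f = (THE I. has_charge_integral T \<nu> f I)"

subsection \<open>Liminal charge structures\<close>

definition liminal_charge_structure ::
    "('a::topological_space set \<Rightarrow> real) \<Rightarrow> ('a set \<Rightarrow> 'a set \<Rightarrow> real) \<Rightarrow> bool" where
  "liminal_charge_structure \<nu> \<rho> \<longleftrightarrow>
     \<rho> \<in> extensional regular_opens \<and>
     (\<forall>R\<in>regular_opens. charge (frontier R) (\<rho> R) \<and>
        (\<forall>U\<in>open_algebra (frontier R). \<nu> U = 0 \<longrightarrow> \<rho> R U = 0)) \<and>
     (\<forall>P. regular_partition P \<longrightarrow>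
        (\<forall>U\<in>open_algebra (\<Union>R\<in>P. frontier R). (\<Sum>R\<in>P. \<rho> R (U \<inter> frontier R)) = \<nu> U))"

definition normal_liminal_charge_structure ::
    "('a::topological_space set \<Rightarrow> real) \<Rightarrow> ('a set \<Rightarrow> 'a set \<Rightarrow> real) \<Rightarrow> bool" where
  "normal_liminal_charge_structure \<nu> \<rho> \<longleftrightarrow>
     liminal_charge_structure \<nu> \<rho> \<and> (\<forall>R\<in>regular_opens. normal_charge (frontier R) (\<rho> R))"

end

theory Submission
  imports Defs
begin

text \<open>
  For a regular open set \<open>R\<close> the functional \<open>content_integral R \<mu>\<close> belongs to the content
  \<open>Q \<mapsto> \<mu> (Q \<inter> R)\<close>. Every finite content \<open>l\<close> yields a normal charge: on closed sets take
  \<open>C \<mapsto> inf {l Q | C \<subseteq> Q}\<close>, extend to all sets by inner approximation with closed sets, and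
  note that normality of the space makes every closed set split this set function additively, so
  that it is additive on the algebra generated by the open sets. Comparing the masses of the
  superlevel sets of \<open>f\<close> shows that the charge \<open>\<nu>\<^sub>R\<close> obtained from \<open>Q \<mapsto> \<mu> (Q \<inter> R)\<close> represents
  \<open>content_integral R \<mu>\<close>. It lives on \<open>closure R\<close> and agrees on \<open>R\<close> with the charge \<open>\<nu>\<close> of \<open>\<mu>\<close>
  itself; its restriction to \<open>frontier R\<close> is the liminal charge. Both uniqueness claims reduce to
  the fact that a normal charge is determined by the integrals of bounded continuous functions,
  the second one by gluing \<open>\<nu>\<close> on \<open>R\<close> with the liminal charge on \<open>frontier R\<close>.
\<close>

subsection \<open>Regular open sets\<close>

lemma regular_opens_iff: "R \<in> regular_opens \<longleftrightarrow> interior (closure R) = R"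
  unfolding regular_opens_def using open_interior[of "closure R"] by (metis (mono_tags, lifting) mem_Collect_eq)

lemma regular_opens_open: "R \<in> regular_opens \<Longrightarrow> open R"
  by (simp add: regular_opens_def)

lemma interior_closure_in_regular_opens: "interior (closure A) \<in> regular_opens"
proof -
  have "interior (closure (interior (closure A))) \<subseteq> interior (closure A)"
    by (metis closure_closure closure_mono interior_mono interior_subset)
  moreover have "interior (closure A) \<subseteq> interior (closure (interior (closure A)))"
    by (simp add: closure_subset interior_maximal)
  ultimately show ?thesis
    by (simp add: regular_opens_iff)
qed

lemma regular_join_in_regular_opens: "regular_join Q R \<in> regular_opens"
  unfolding regular_join_def by (rule interior_closure_in_regular_opens)

lemma Un_subset_regular_join:
  "Q \<in> regular_opens \<Longrightarrow> R \<in> regular_opens \<Longrightarrow> Q \<union> R \<subseteq> regular_join Q R"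
  unfolding regular_join_def
  by (rule interior_maximal[OF closure_subset]) (simp add: open_Un regular_opens_open)

lemma empty_in_regular_opens [simp]: "{} \<in> regular_opens"
  and UNIV_in_regular_opens [simp]: "UNIV \<in> regular_opens"
  by (simp_all add: regular_opens_def)

lemma Int_in_regular_opens:
  assumes "Q \<in> regular_opens" "R \<in> regular_opens"
  shows "Q \<inter> R \<in> regular_opens"
proof -
  have "interior (closure (Q \<inter> R)) \<subseteq> Q \<inter> R"
    by (metis assms Int_lower1 Int_lower2 closure_mono interior_mono le_inf_iff regular_opens_iff)
  moreover have "Q \<inter> R \<subseteq> interior (closure (Q \<inter> R))"
    using assms by (simp add: closure_subset interior_maximal open_Int regular_opens_open)
  ultimately show ?thesis
    unfolding regular_opens_iff by (rule antisym)
qed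

lemma closure_Compl_closure: "R \<in> regular_opens \<Longrightarrow> closure (- closure R) = - R"
  by (simp add: closure_complement regular_opens_iff)

lemma Compl_closure_in_regular_opens: "R \<in> regular_opens \<Longrightarrow> - closure R \<in> regular_opens"
  by (simp add: regular_opens_iff closure_Compl_closure interior_complement)

lemma Diff_closure_in_regular_opens:
  "Q \<in> regular_opens \<Longrightarrow> R \<in> regular_opens \<Longrightarrow> Q - closure R \<in> regular_opens"
  by (simp add: Diff_eq Int_in_regular_opens Compl_closure_in_regular_opens)

text \<open>In the Boolean algebra \<open>Q - closure R\<close> is the relative complement of
  \<open>R\<close> in \<open>Q\<close>. The points of \<open>Q\<close> outside both pieces lie in
  \<open>closure R\<close>, so the closure of the union covers \<open>Q\<close>.\<close>

lemma regular_join_Diff_closure: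
  assumes "Q \<in> regular_opens" "R \<in> regular_opens" "R \<subseteq> Q"
  shows "regular_join R (Q - closure R) = Q"
proof
  show "regular_join R (Q - closure R) \<subseteq> Q"
    unfolding regular_join_def using assms
    by (metis Diff_subset Un_least closure_mono interior_mono regular_opens_iff)
  have "Q \<subseteq> closure (R \<union> (Q - closure R))"
    using closure_subset[of "Q - closure R"] by (auto simp: closure_Un)
  then show "Q \<subseteq> regular_join R (Q - closure R)"
    unfolding regular_join_def using assms by (simp add: interior_maximal regular_opens_open)
qed

text \<open>The T4 property gives an open \<open>V\<close> around \<open>C\<close> whose closure
  stays in \<open>U\<close>; passing to \<open>interior (closure V)\<close> makes it regular without
  leaving that closure.\<close>

lemma regular_open_between:
  fixes C U :: "'a::t4_space set"
  assumes "closed C" "open U" "C \<subseteq> U"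
  obtains Q where "Q \<in> regular_opens" "C \<subseteq> Q" "closure Q \<subseteq> U"
proof -
  obtain V W where VW: "open V" "open W" "C \<subseteq> V" "- U \<subseteq> W" "V \<inter> W = {}"
    using t4_space[of C "- U"] assms by (metis Diff_eq_empty_iff closed_Compl diff_eq)
  have "closure V \<subseteq> - W"
    using VW by (intro closure_minimal) auto
  show thesis
  proof
    show "interior (closure V) \<in> regular_opens"
      by (rule interior_closure_in_regular_opens)
    show "C \<subseteq> interior (closure V)"
      using VW by (meson closure_subset interior_maximal order_trans)
    have "closure (interior (closure V)) \<subseteq> closure V"
      by (simp add: closure_minimal interior_subset)
    then show "closure (interior (closure V)) \<subseteq> U"
      using \<open>closure V \<subseteq> - W\<close> VW by blast
  qed
qed

subsection \<open>Charges on the algebra of open sets\<close>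

lemma open_algebra_UNIV: "open_algebra UNIV = algebra UNIV hull {U. open U}"
  by (simp add: open_algebra_def)

lemma open_algebra_as_trace: "open_algebra T = (\<lambda>A. A \<inter> T) ` open_algebra UNIV"
  by (auto simp: open_algebra_def)

lemma algebra_open_algebra: "algebra T (open_algebra T)"
proof -
  \<comment> \<open>The whole space comes first: an intersection of algebras is an algebra, so the
    hull is one itself. The general case takes traces.\<close>
  have *: "algebra UNIV (open_algebra (UNIV :: 'a set))"
    unfolding open_algebra_UNIV
  proof (rule hull_in)
    fix F :: "'a set set set" assume "\<forall>M\<in>F. algebra UNIV M"
    then show "algebra UNIV (\<Inter>F)"
      unfolding algebra_iff_Un by auto
  qed
  show ?thesis
    unfolding algebra_iff_Un open_algebra_as_trace[of T]
  proof (intro conjI ballI)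
    interpret algebra UNIV "open_algebra (UNIV :: 'a set)" by (rule *)
    show "{} \<in> (\<lambda>A. A \<inter> T) ` open_algebra UNIV"
      by (rule image_eqI[of _ _ "{}"]) auto
    fix a assume "a \<in> (\<lambda>A. A \<inter> T) ` open_algebra UNIV"
    then obtain A where A: "A \<in> open_algebra UNIV" "a = A \<inter> T" by blast
    show "T - a \<in> (\<lambda>A. A \<inter> T) ` open_algebra UNIV"
      by (rule image_eqI[of _ _ "UNIV - A"]) (use A in auto)
    fix b assume "b \<in> (\<lambda>A. A \<inter> T) ` open_algebra UNIV"
    then obtain B where B: "B \<in> open_algebra UNIV" "b = B \<inter> T" by blast
    show "a \<union> b \<in> (\<lambda>A. A \<inter> T) ` open_algebra UNIV"
      by (rule image_eqI[of _ _ "A \<union> B"]) (use A B in auto)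
  qed auto
qed

lemma open_in_open_algebra: "open U \<Longrightarrow> U \<in> open_algebra UNIV"
  unfolding open_algebra_UNIV by (rule hull_inc) simp

lemma closed_in_open_algebra:
  assumes "closed C"
  shows "C \<in> open_algebra UNIV"
proof -
  interpret algebra UNIV "open_algebra (UNIV :: 'a set)" by (rule algebra_open_algebra)
  show ?thesis
    using compl_sets[OF open_in_open_algebra[OF open_Compl[OF assms]]] by simp
qed

lemma Int_in_open_algebra: "A \<in> open_algebra UNIV \<Longrightarrow> A \<inter> T \<in> open_algebra T"
  by (auto simp: open_algebra_as_trace[of T])

lemma open_algebra_subspace:
  assumes "T \<in> open_algebra UNIV"
  shows "open_algebra T = {A \<in> open_algebra UNIV. A \<subseteq> T}"
proof -
  interpret algebra UNIV "open_algebra (UNIV :: 'a set)" by (rule algebra_open_algebra)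
  show ?thesis
    using assms Int by (force simp: open_algebra_as_trace[of T] image_iff)
qed

lemma closedin_in_open_algebra: "closedin (top_of_set T) C \<Longrightarrow> C \<in> open_algebra T"
  by (metis Int_in_open_algebra closed_in_open_algebra closedin_closed inf.commute)

lemma openin_in_open_algebra: "openin (top_of_set T) U \<Longrightarrow> U \<in> open_algebra T"
  by (metis Int_in_open_algebra open_in_open_algebra openin_open inf.commute)

text \<open>This keeps only additivity and positivity of \<open>charge\<close>, so that a charge on
  the whole space can be used on \<open>open_algebra T\<close> as its own restriction although it is
  not extensional there.\<close>

locale finite_charge =
  fixes T :: "'a::topological_space set" and \<nu> :: "'a set \<Rightarrow> real"
  assumes additive: "additive (open_algebra T) \<nu>"
    and nonneg: "A \<in> open_algebra T \<Longrightarrow> 0 \<le> \<nu> A"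

sublocale finite_charge \<subseteq> algebra T "open_algebra T"
  by (rule algebra_open_algebra)

context finite_charge
begin

lemma Un_disjoint: "\<lbrakk>A \<in> open_algebra T; B \<in> open_algebra T; A \<inter> B = {}\<rbrakk> \<Longrightarrow> \<nu> (A \<union> B) = \<nu> A + \<nu> B"
  using additive by (auto simp: additive_def)

lemma charge_empty: "\<nu> {} = 0"
  using Un_disjoint[of "{}" "{}"] by simp

lemma charge_Diff:
  assumes "A \<in> open_algebra T" "B \<in> open_algebra T" "B \<subseteq> A"
  shows "\<nu> (A - B) = \<nu> A - \<nu> B"
proof -
  have "(A - B) \<union> B = A" "(A - B) \<inter> B = {}"
    using assms(3) by auto
  then show ?thesis
    using Un_disjoint[of "A - B" B] assms(1,2) by (metis Diff add_diff_cancel_right')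
qed

lemma charge_mono:
  assumes "A \<in> open_algebra T" "B \<in> open_algebra T" "B \<subseteq> A"
  shows "\<nu> B \<le> \<nu> A"
  using charge_Diff[OF assms] nonneg[OF Diff[OF assms(1,2)]] by simp

lemma charge_UN:
  assumes "finite I" "\<And>i. i \<in> I \<Longrightarrow> A i \<in> open_algebra T" "disjoint_family_on A I"
  shows "\<nu> (\<Union>i\<in>I. A i) = (\<Sum>i\<in>I. \<nu> (A i))"
  using assms
proof (induction I rule: finite_induct)
  case empty
  then show ?case by (simp add: charge_empty)
next
  case (insert i I)
  have "(\<Union>j\<in>I. A j) \<in> open_algebra T"
    using insert by (intro finite_UN) auto
  moreover have "A i \<inter> (\<Union>j\<in>I. A j) = {}"
    using insert.hyps(2) insert.prems(2) by (force simp: disjoint_family_on_def)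
  moreover have "disjoint_family_on A I"
    using insert.prems(2) by (rule disjoint_family_on_mono[rotated]) auto
  ultimately show ?case
    using insert by (simp add: Un_disjoint)
qed

end

lemma finite_charge_of_charge: "charge T \<nu> \<Longrightarrow> finite_charge T \<nu>"
  by (auto simp: charge_def finite_charge_def dest!: PiE_mem)

lemma finite_charge_subspace:
  assumes "finite_charge UNIV \<nu>" "T \<in> open_algebra UNIV"
  shows "finite_charge T \<nu>"
  using assms by (auto simp: finite_charge_def additive_def open_algebra_subspace)

text \<open>Outer regularity comes from inner regularity by complements: a closed \<open>C\<close>
  filling most of \<open>T - B\<close> leaves the open set \<open>T - C\<close> around
  \<open>B\<close>.\<close>

lemma normal_chargeI:
  assumes "charge T \<nu>"
    and inner: "\<And>B e. \<lbrakk>B \<in> open_algebra T; 0 < e\<rbrakk> \<Longrightarrow>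
      \<exists>C\<subseteq>B. closedin (top_of_set T) C \<and> \<nu> B - e < \<nu> C"
  shows "normal_charge T \<nu>"
  unfolding normal_charge_def
proof (intro conjI ballI)
  interpret finite_charge T \<nu>
    using assms(1) by (rule finite_charge_of_charge)
  fix B assume B: "B \<in> open_algebra T"
  show "\<nu> B = Sup {\<nu> C |C. C \<subseteq> B \<and> closedin (top_of_set T) C}"
  proof (rule cSup_eq_non_empty[symmetric])
    show "{\<nu> C |C. C \<subseteq> B \<and> closedin (top_of_set T) C} \<noteq> {}"
      by auto
    show "x \<le> \<nu> B" if "x \<in> {\<nu> C |C. C \<subseteq> B \<and> closedin (top_of_set T) C}" for x
      using that B by (auto intro!: charge_mono closedin_in_open_algebra)
    fix y assume y: "\<And>x. x \<in> {\<nu> C |C. C \<subseteq> B \<and> closedin (top_of_set T) C} \<Longrightarrow> x \<le> y"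
    show "\<nu> B \<le> y"
    proof (rule field_le_epsilon)
      fix e :: real assume "0 < e"
      then obtain C where "C \<subseteq> B" "closedin (top_of_set T) C" "\<nu> B - e < \<nu> C"
        using inner[OF B] by blast
      with y[of "\<nu> C"] show "\<nu> B \<le> y + e"
        by fastforce
    qed
  qed
  have BT: "B \<subseteq> T"
    using B sets_into_space by blast
  show "\<nu> B = Inf {\<nu> U |U. B \<subseteq> U \<and> openin (top_of_set T) U}"
  proof (rule cInf_eq_non_empty[symmetric])
    show "{\<nu> U |U. B \<subseteq> U \<and> openin (top_of_set T) U} \<noteq> {}"
      using BT by auto
    show "\<nu> B \<le> x" if "x \<in> {\<nu> U |U. B \<subseteq> U \<and> openin (top_of_set T) U}" for x
      using that B by (auto intro!: charge_mono openin_in_open_algebra)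
    fix y assume y: "\<And>x. x \<in> {\<nu> U |U. B \<subseteq> U \<and> openin (top_of_set T) U} \<Longrightarrow> y \<le> x"
    show "y \<le> \<nu> B"
    proof (rule field_le_epsilon)
      fix e :: real assume "0 < e"
      then obtain C where C: "C \<subseteq> T - B" "closedin (top_of_set T) C" "\<nu> (T - B) - e < \<nu> C"
        using inner[OF compl_sets[OF B]] by blast
      have "openin (top_of_set T) (T - C)"
        using C(2) by (metis openin_diff openin_subtopology_self)
      with y[of "\<nu> (T - C)"] C BT have "y \<le> \<nu> (T - C)"
        by blast
      then show "y \<le> \<nu> B + e"
        using C(1,3) charge_Diff[OF top B BT]
          charge_Diff[OF top closedin_in_open_algebra[OF C(2)] order_trans[OF C(1) Diff_subset]]
        by linarith
    qed
  qed
qed (rule assms(1))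

lemma normal_charge_inner:
  assumes "normal_charge T \<nu>" "B \<in> open_algebra T" "0 < e"
  obtains C where "C \<subseteq> B" "closedin (top_of_set T) C" "\<nu> B - e < \<nu> C"
proof -
  let ?X = "{\<nu> C |C. C \<subseteq> B \<and> closedin (top_of_set T) C}"
  have "\<nu> B = Sup ?X"
    using assms(1,2) unfolding normal_charge_def by blast
  then have "\<nu> B - e < Sup ?X"
    using assms(3) by linarith
  moreover have "?X \<noteq> {}" by auto
  ultimately show thesis
    using that less_cSupD[of ?X "\<nu> B - e"] by blast
qed

lemma normal_charge_outer:
  assumes "normal_charge T \<nu>" "B \<in> open_algebra T" "0 < e"
  obtains U where "B \<subseteq> U" "openin (top_of_set T) U" "\<nu> U < \<nu> B + e"
proof -
  let ?X = "{\<nu> U |U. B \<subseteq> U \<and> openin (top_of_set T) U}"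
  have "\<nu> B = Inf ?X"
    using assms(1,2) unfolding normal_charge_def by blast
  then have "Inf ?X < \<nu> B + e"
    using assms(3) by linarith
  moreover have "?X \<noteq> {}"
    using assms(2) by (auto simp: open_algebra_def intro!: exI[of _ T])
  ultimately show thesis
    using that cInf_lessD[of ?X "\<nu> B + e"] by blast
qed

subsection \<open>The normal charge of a content\<close>

locale finite_content =
  fixes l :: "'a::t4_space set \<Rightarrow> real"
  assumes nonneg: "R \<in> regular_opens \<Longrightarrow> 0 \<le> l R"
    and join: "\<lbrakk>Q \<in> regular_opens; R \<in> regular_opens; Q \<inter> R = {}\<rbrakk> \<Longrightarrow> l (regular_join Q R) = l Q + l R"
begin

lemma empty: "l {} = 0"
  using join[of "{}" "{}"] by (simp add: regular_join_def)

lemma Diff_closure: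
  assumes "Q \<in> regular_opens" "R \<in> regular_opens" "R \<subseteq> Q"
  shows "l (Q - closure R) = l Q - l R"
proof -
  have "R \<inter> (Q - closure R) = {}"
    using closure_subset by auto
  then show ?thesis
    using join[of R "Q - closure R"] assms
    by (simp add: Diff_closure_in_regular_opens regular_join_Diff_closure)
qed

lemma mono:
  assumes "Q \<in> regular_opens" "R \<in> regular_opens" "R \<subseteq> Q"
  shows "l R \<le> l Q"
  using Diff_closure[OF assms] nonneg[OF Diff_closure_in_regular_opens[OF assms(1,2)]] by simp

text \<open>The part of the join outside \<open>closure Q\<close> is open and lies in
  \<open>closure R\<close>, hence in \<open>R\<close> by regularity. It is also the relative
  complement of \<open>Q\<close> in the join.\<close>

lemma subadditive:
  assumes "Q \<in> regular_opens" "R \<in> regular_opens"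
  shows "l (regular_join Q R) \<le> l Q + l R"
proof -
  let ?J = "regular_join Q R"
  have J: "?J \<in> regular_opens"
    by (rule regular_join_in_regular_opens)
  have "Q \<subseteq> ?J"
    using Un_subset_regular_join[OF assms] by simp
  have "?J - closure Q \<subseteq> closure R"
    unfolding regular_join_def using interior_subset[of "closure (Q \<union> R)"] by (auto simp: closure_Un)
  then have "?J - closure Q \<subseteq> R"
    using interior_maximal[of "?J - closure Q" "closure R"] assms J
    by (simp add: regular_opens_iff regular_opens_open open_Diff)
  then have "l (?J - closure Q) \<le> l R"
    using assms J by (simp add: mono Diff_closure_in_regular_opens)
  then show ?thesis
    using Diff_closure[OF J assms(1) \<open>Q \<subseteq> ?J\<close>] by simp
qed

section \<open>Outer mass by regular open covers and inner mass by closed subsets\<close>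

definition outer_mass :: "'a set \<Rightarrow> real" where
  "outer_mass C = Inf {l Q | Q. Q \<in> regular_opens \<and> C \<subseteq> Q}"

text \<open>Defined on all sets rather than on the algebra, because arbitrary sets serve as test
  sets in the splitting argument.\<close>

definition inner_mass :: "'a set \<Rightarrow> real" where
  "inner_mass A = Sup {outer_mass C | C. closed C \<and> C \<subseteq> A}"

lemma outer_mass_le: "\<lbrakk>Q \<in> regular_opens; C \<subseteq> Q\<rbrakk> \<Longrightarrow> outer_mass C \<le> l Q"
  unfolding outer_mass_def by (rule cInf_lower) (auto intro!: bdd_belowI[of _ 0] nonneg)

lemma outer_mass_greatest:
  "(\<And>Q. \<lbrakk>Q \<in> regular_opens; C \<subseteq> Q\<rbrakk> \<Longrightarrow> x \<le> l Q) \<Longrightarrow> x \<le> outer_mass C"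
  unfolding outer_mass_def by (rule cInf_greatest) (auto intro: UNIV_in_regular_opens)

lemma outer_mass_mono: "C \<subseteq> D \<Longrightarrow> outer_mass C \<le> outer_mass D"
  by (rule outer_mass_greatest) (auto intro: outer_mass_le)

lemma outer_mass_empty: "outer_mass {} = 0"
  using outer_mass_le[of "{}" "{}"] outer_mass_greatest[of "{}" 0] empty nonneg by fastforce

lemma outer_mass_UNIV: "outer_mass UNIV = l UNIV"
  by (rule antisym) (auto intro: outer_mass_le outer_mass_greatest simp: top.extremum_unique)

text \<open>Normality supplies a regular \<open>Q1\<close> around \<open>C\<close> whose closure
  misses \<open>D\<close>. It divides every cover \<open>Q\<close> of the union into a cover of
  \<open>C\<close> and a disjoint cover of \<open>D\<close>.\<close>

lemma outer_mass_disjoint: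
  assumes "closed C" "closed D" "C \<inter> D = {}"
  shows "outer_mass C + outer_mass D \<le> outer_mass (C \<union> D)"
proof (rule outer_mass_greatest)
  fix Q assume Q: "Q \<in> regular_opens" "C \<union> D \<subseteq> Q"
  obtain Q1 where Q1: "Q1 \<in> regular_opens" "C \<subseteq> Q1" "closure Q1 \<subseteq> - D"
    using regular_open_between[of C "- D"] assms by blast
  have "D \<subseteq> Q - closure Q1" "C \<subseteq> Q \<inter> Q1"
    using Q Q1 by auto
  moreover have "Q \<inter> Q1 \<in> regular_opens"
    using Q Q1 by (simp add: Int_in_regular_opens)
  \<comment> \<open>\<open>Q1\<close> may stick out of \<open>Q\<close>, so the relative complement
    is taken of \<open>Q \<inter> Q1\<close>, and monotonicity bridges the difference.\<close>
  moreover have "l (Q - closure Q1) \<le> l (Q - closure (Q \<inter> Q1))"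
    using Q Q1 calculation closure_mono[of "Q \<inter> Q1" Q1]
    by (intro mono) (auto simp: Diff_closure_in_regular_opens)
  moreover have "l (Q - closure (Q \<inter> Q1)) = l Q - l (Q \<inter> Q1)"
    using Q calculation by (intro Diff_closure) auto
  ultimately show "outer_mass C + outer_mass D \<le> l Q"
    using outer_mass_le[of "Q \<inter> Q1" C] outer_mass_le[of "Q - closure Q1" D] Q Q1
      Diff_closure_in_regular_opens[of Q Q1] by linarith
qed

text \<open>Any cover \<open>P\<close> of \<open>C - Q\<close> joined with \<open>Q\<close> covers
  \<open>C\<close>, and the content is subadditive.\<close>

lemma outer_mass_subtract:
  assumes "Q \<in> regular_opens"
  shows "outer_mass C \<le> l Q + outer_mass (C - Q)"
proof -
  have "outer_mass C - l Q \<le> outer_mass (C - Q)"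
  proof (rule outer_mass_greatest)
    fix P assume P: "P \<in> regular_opens" "C - Q \<subseteq> P"
    have "Q \<union> P \<subseteq> regular_join Q P"
      using assms P(1) by (rule Un_subset_regular_join)
    then have "outer_mass C \<le> l (regular_join Q P)"
      using P by (intro outer_mass_le regular_join_in_regular_opens) auto
    then show "outer_mass C - l Q \<le> l P"
      using subadditive[OF assms P(1)] by linarith
  qed
  then show ?thesis by linarith
qed

lemma inner_mass_upper: "\<lbrakk>closed C; C \<subseteq> A\<rbrakk> \<Longrightarrow> outer_mass C \<le> inner_mass A"
  unfolding inner_mass_def
  by (rule cSup_upper) (auto intro!: bdd_aboveI[of _ "outer_mass UNIV"] outer_mass_mono)

lemma inner_mass_least: "(\<And>C. \<lbrakk>closed C; C \<subseteq> A\<rbrakk> \<Longrightarrow> outer_mass C \<le> x) \<Longrightarrow> inner_mass A \<le> x"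
  unfolding inner_mass_def by (rule cSup_least) auto

lemma inner_mass_mono: "A \<subseteq> B \<Longrightarrow> inner_mass A \<le> inner_mass B"
  by (rule inner_mass_least) (auto intro: inner_mass_upper)

lemma inner_mass_closed: "closed C \<Longrightarrow> inner_mass C = outer_mass C"
  by (rule antisym) (auto intro: inner_mass_upper inner_mass_least outer_mass_mono)

lemma inner_mass_empty: "inner_mass {} = 0"
  by (simp add: inner_mass_closed outer_mass_empty)

lemma inner_mass_nonneg: "0 \<le> inner_mass A"
  using inner_mass_mono[of "{}" A] by (simp add: inner_mass_empty)

lemma inner_mass_UNIV: "inner_mass UNIV = l UNIV"
  by (simp add: inner_mass_closed outer_mass_UNIV)

lemma inner_mass_le_content: "\<lbrakk>Q \<in> regular_opens; A \<subseteq> Q\<rbrakk> \<Longrightarrow> inner_mass A \<le> l Q"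
  by (rule inner_mass_least) (auto intro: outer_mass_le)

lemma inner_mass_disjoint:
  assumes "A \<inter> B = {}"
  shows "inner_mass A + inner_mass B \<le> inner_mass (A \<union> B)"
proof -
  have "inner_mass A \<le> inner_mass (A \<union> B) - inner_mass B"
  proof (rule inner_mass_least)
    fix C assume C: "closed C" "C \<subseteq> A"
    have "inner_mass B \<le> inner_mass (A \<union> B) - outer_mass C"
    proof (rule inner_mass_least)
      fix D assume D: "closed D" "D \<subseteq> B"
      have "outer_mass C + outer_mass D \<le> outer_mass (C \<union> D)"
        using C D assms by (intro outer_mass_disjoint) auto
      also have "\<dots> \<le> inner_mass (A \<union> B)"
        using C D by (intro inner_mass_upper) auto
      finally show "outer_mass D \<le> inner_mass (A \<union> B) - outer_mass C" by linarith
    qed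
    then show "outer_mass C \<le> inner_mass (A \<union> B) - inner_mass B" by linarith
  qed
  then show ?thesis by linarith
qed

text \<open>Superadditivity gives one direction. For the other, cover \<open>C \<inter> E\<close> by
  a regular \<open>Q\<close>: the remainder \<open>C - Q\<close> is closed and lies in
  \<open>A - E\<close>, so the inner mass there bounds what \<open>Q\<close> misses; then take the
  infimum over \<open>Q\<close>.\<close>

lemma inner_mass_split_closed:
  assumes "closed E"
  shows "inner_mass A = inner_mass (A \<inter> E) + inner_mass (A - E)"
proof (rule antisym)
  show "inner_mass A \<le> inner_mass (A \<inter> E) + inner_mass (A - E)"
  proof (rule inner_mass_least)
    fix C assume C: "closed C" "C \<subseteq> A"
    have "outer_mass C - inner_mass (A - E) \<le> outer_mass (C \<inter> E)"
    proof (rule outer_mass_greatest)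
      fix Q assume Q: "Q \<in> regular_opens" "C \<inter> E \<subseteq> Q"
      have "outer_mass (C - Q) \<le> inner_mass (A - E)"
        using C Q by (intro inner_mass_upper closed_Diff regular_opens_open) auto
      then show "outer_mass C - inner_mass (A - E) \<le> l Q"
        using outer_mass_subtract[OF Q(1), of C] by linarith
    qed
    also have "\<dots> \<le> inner_mass (A \<inter> E)"
      using C assms by (intro inner_mass_upper) auto
    finally show "outer_mass C \<le> inner_mass (A \<inter> E) + inner_mass (A - E)" by linarith
  qed
  have "(A \<inter> E) \<union> (A - E) = A" by blast
  then show "inner_mass (A \<inter> E) + inner_mass (A - E) \<le> inner_mass A"
    using inner_mass_disjoint[of "A \<inter> E" "A - E"] by auto
qed


text \<open>A Caratheodory argument: the sets that split every test set form an algebra, and it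
  contains the open sets since splitting is symmetric under complement.\<close>

lemma inner_mass_split:
  assumes "E \<in> open_algebra UNIV"
  shows "inner_mass A = inner_mass (A \<inter> E) + inner_mass (A - E)"
proof -
  let ?M = "{E. \<forall>A. inner_mass A = inner_mass (A \<inter> E) + inner_mass (A - E)}"
  have "algebra UNIV ?M"
    unfolding algebra_iff_Un
  proof (intro conjI ballI)
    fix E F assume E: "E \<in> ?M" and F: "F \<in> ?M"
    show "E \<union> F \<in> ?M"
    proof (rule CollectI, rule allI)
      fix A
      have "inner_mass A = inner_mass (A \<inter> E) + inner_mass (A - E)"
        "inner_mass (A - E) = inner_mass ((A - E) \<inter> F) + inner_mass (A - E - F)"
        "inner_mass (A \<inter> (E \<union> F)) = inner_mass (A \<inter> (E \<union> F) \<inter> E) + inner_mass (A \<inter> (E \<union> F) - E)"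
        using E F by blast+
      moreover have "A \<inter> (E \<union> F) \<inter> E = A \<inter> E" "A \<inter> (E \<union> F) - E = (A - E) \<inter> F" "A - E - F = A - (E \<union> F)"
        by auto
      ultimately show "inner_mass A = inner_mass (A \<inter> (E \<union> F)) + inner_mass (A - (E \<union> F))"
        by simp
    qed
  next
    fix E assume E: "E \<in> ?M"
    show "UNIV - E \<in> ?M"
    proof (rule CollectI, rule allI)
      fix A
      have "A \<inter> (UNIV - E) = A - E" "A - (UNIV - E) = A \<inter> E"
        by auto
      moreover have "inner_mass A = inner_mass (A \<inter> E) + inner_mass (A - E)"
        using E by blast
      ultimately show "inner_mass A = inner_mass (A \<inter> (UNIV - E)) + inner_mass (A - (UNIV - E))"
        by (metis add.commute)
    qed
  qed (simp_all add: inner_mass_empty)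
  moreover have "{U. open U} \<subseteq> ?M"
  proof (intro subsetI CollectI allI)
    fix U A :: "'a set" assume "U \<in> {U. open U}"
    moreover have "A \<inter> - U = A - U" "A - - U = A \<inter> U"
      by auto
    ultimately show "inner_mass A = inner_mass (A \<inter> U) + inner_mass (A - U)"
      using inner_mass_split_closed[of "- U" A] by (simp add: closed_Compl add.commute)
  qed
  ultimately have "algebra UNIV hull {U. open U} \<subseteq> ?M"
    by (simp add: hull_minimal)
  then show ?thesis
    using assms by (auto simp: open_algebra_def)
qed

definition associated_charge :: "'a set \<Rightarrow> real" where
  "associated_charge = restrict inner_mass (open_algebra UNIV)"

lemma associated_charge_eq: "A \<in> open_algebra UNIV \<Longrightarrow> associated_charge A = inner_mass A"
  by (simp add: associated_charge_def)

lemma charge_associated_charge: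
  assumes "l UNIV \<le> 1"
  shows "charge UNIV associated_charge"
  unfolding charge_def additive_def
proof (intro conjI ballI impI)
  show "associated_charge \<in> open_algebra UNIV \<rightarrow>\<^sub>E {0..1}"
    using order_trans[OF inner_mass_mono[OF subset_UNIV] assms[folded inner_mass_UNIV]]
    by (auto simp: associated_charge_def inner_mass_nonneg)
  fix A B :: "'a set" assume AB: "A \<in> open_algebra UNIV" "B \<in> open_algebra UNIV" "A \<inter> B = {}"
  then have "A \<union> B \<in> open_algebra UNIV"
    using algebra.axioms(1)[OF algebra_open_algebra, THEN ring_of_sets.Un] by blast
  moreover have "(A \<union> B) \<inter> A = A" "A \<union> B - A = B"
    using AB by auto
  ultimately show "associated_charge (A \<union> B) = associated_charge A + associated_charge B"
    using inner_mass_split[OF AB(1), of "A \<union> B"] AB by (simp add: associated_charge_eq)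
qed

text \<open>Inner regularity is built into \<open>inner_mass\<close>, a supremum over closed subsets
  on which it agrees with \<open>outer_mass\<close>.\<close>

lemma normal_charge_associated_charge:
  assumes "l UNIV \<le> 1"
  shows "normal_charge UNIV associated_charge"
proof (rule normal_chargeI[OF charge_associated_charge[OF assms]])
  fix B :: "'a set" and e :: real assume B: "B \<in> open_algebra UNIV" "0 < e"
  have "\<not> inner_mass B \<le> inner_mass B - e"
    using B by simp
  then obtain C where C: "closed C" "C \<subseteq> B" "inner_mass B - e < outer_mass C"
    using inner_mass_least[of B "inner_mass B - e"] by force
  then show "\<exists>C\<subseteq>B. closedin (top_of_set UNIV) C \<and> associated_charge B - e < associated_charge C"
    using B closed_in_open_algebra[of C]
    by (auto simp: associated_charge_eq inner_mass_closed)
qed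

end



subsection \<open>Level sets and integrals against charges\<close>

lemma nonpos_of_le_divide_Suc:
  fixes x c :: real
  assumes "\<And>K. x \<le> c / real (Suc K)"
  shows "x \<le> 0"
proof -
  have "(\<lambda>K. c / real (Suc K)) \<longlonglongrightarrow> 0"
    by (intro real_tendsto_divide_at_top filterlim_compose[OF filterlim_real_sequentially filterlim_Suc]) auto
  then show ?thesis
    by (rule Lim_bounded2) (use assms in auto)
qed

text \<open>For a decreasing chain this is the index of the last member containing \<open>x\<close>.
  The maximum is meaningful once \<open>A 0\<close> is the whole space and \<open>K\<close> is
  positive.\<close>

definition level :: "(nat \<Rightarrow> 'a set) \<Rightarrow> nat \<Rightarrow> 'a \<Rightarrow> nat" where
  "level A K x = Max {i. i < K \<and> x \<in> A i}"

lemma level: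
  assumes "antimono A" "A 0 = UNIV" "A K = {}"
  shows "level A K x < K" "x \<in> A (level A K x)" "x \<notin> A (Suc (level A K x))"
    "i < K \<Longrightarrow> level A K x = i \<longleftrightarrow> x \<in> A i - A (Suc i)"
proof -
  let ?S = "{i. i < K \<and> x \<in> A i}"
  have "0 < K"
    using assms(2,3) by (metis UNIV_not_empty gr0I)
  then have S: "finite ?S" "0 \<in> ?S"
    using assms(2) by auto
  have *: "level A K x \<in> ?S"
    unfolding level_def by (rule Max_in) (use S in auto)
  show **: "level A K x < K" "x \<in> A (level A K x)"
    using * by auto
  have max: "i \<le> level A K x" if "i < K" "x \<in> A i" for i
    unfolding level_def using that by (intro Max_ge) auto
  show ***: "x \<notin> A (Suc (level A K x))"
  proof
    assume "x \<in> A (Suc (level A K x))"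
    \<comment> \<open>The successor index leaves the range of the maximum only at \<open>K\<close>,
      where the chain is empty.\<close>
    moreover from this have "Suc (level A K x) \<noteq> K"
      using assms(3) by auto
    ultimately show False
      using max[of "Suc (level A K x)"] **(1) by linarith
  qed
  show "level A K x = i \<longleftrightarrow> x \<in> A i - A (Suc i)" if "i < K"
  proof
    assume "x \<in> A i - A (Suc i)"
    moreover have "\<not> i < level A K x" if "x \<notin> A (Suc i)"
      using that **(2) antimonoD[OF assms(1), of "Suc i" "level A K x"] by auto
    ultimately show "level A K x = i"
      using max[of i] \<open>i < K\<close> by fastforce
  qed (use ** *** in auto)
qed

lemma sum_telescope_lessThan: "(\<Sum>i<K. q i - q (Suc i)) = q 0 - (q K :: real)" for K :: nat
  by (induction K) auto

section \<open>Riemann sums over an equidistant grid\<close>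

definition grid :: "real \<Rightarrow> nat \<Rightarrow> nat \<Rightarrow> real" where
  "grid B K i = - B + real i * (2 * B / real K)"

lemma grid_Suc: "grid B K (Suc i) = grid B K i + 2 * B / real K"
  by (simp add: grid_def add_divide_distrib distrib_right)

lemma grid_0: "grid B K 0 = - B" and grid_end: "K > 0 \<Longrightarrow> grid B K K = B"
  by (simp_all add: grid_def)

lemma grid_strict_mono: "0 < B \<Longrightarrow> 0 < K \<Longrightarrow> strict_mono (grid B K)"
  by (rule strict_mono_Suc_iff[THEN iffD2]) (simp add: grid_Suc)

text \<open>
  A Riemann sum for a function with values in \<open>{-B<..<B}\<close>, where \<open>F i\<close> is the mass on which the
  function is above the level \<open>grid B K i\<close>.
\<close>

definition level_sum :: "real \<Rightarrow> nat \<Rightarrow> (nat \<Rightarrow> real) \<Rightarrow> real" where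
  "level_sum B K F = (\<Sum>i<K. grid B K i * (F i - F (Suc i)))"

lemma level_sum_add: "level_sum B K (\<lambda>i. F i + G i) = level_sum B K F + level_sum B K G"
  by (simp add: level_sum_def sum.distrib[symmetric] algebra_simps)

text \<open>Summation by parts. It replaces the differences of \<open>F\<close> by its values with
  one common nonnegative weight when \<open>B\<close> is nonnegative, which makes the sums
  comparable pointwise.\<close>

lemma level_sum_Abel:
  assumes "0 < K" "F K = 0"
  shows "level_sum B K F = - B * F 0 + 2 * B / real K * (\<Sum>i = 1..<K. F i)"
proof -
  \<comment> \<open>The induction runs over the upper limit with the grid fixed; its boundary term
    disappears at \<open>n = K\<close>, where \<open>F K = 0\<close>.\<close>
  have "(\<Sum>i<n. grid B K i * (F i - F (Suc i)))
      = - B * F 0 + 2 * B / real K * (\<Sum>i = 1..<Suc n. F i) - grid B K n * F n" for n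
    by (induction n) (simp_all add: grid_Suc grid_0 algebra_simps)
  from this[of K] show ?thesis
    using assms by (simp add: level_sum_def)
qed

lemma level_sum_mono:
  assumes "0 \<le> B" "0 < K" "F K = 0" "G K = 0" "F 0 = G 0" "\<And>i. \<lbrakk>0 < i; i < K\<rbrakk> \<Longrightarrow> F i \<le> G i"
  shows "level_sum B K F \<le> level_sum B K G"
proof -
  have "(\<Sum>i = 1..<K. F i) \<le> (\<Sum>i = 1..<K. G i)"
    using assms(6) by (intro sum_mono) simp
  then have "2 * B / real K * (\<Sum>i = 1..<K. F i) \<le> 2 * B / real K * (\<Sum>i = 1..<K. G i)"
    using assms(1) by (intro mult_left_mono) auto
  then show ?thesis
    using assms(2-5) by (simp add: level_sum_Abel)
qed

text \<open>When \<open>F\<close> lags one index behind \<open>G\<close>, the Abel form exposes a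
  single surplus term, bounded by \<open>F 0\<close>. The price is one grid step times
  \<open>F 0\<close>.\<close>

lemma level_sum_shift:
  assumes "0 \<le> B" "0 < K" "F K = 0" "G K = 0" "F 0 = G 0" "\<And>i. \<lbrakk>0 < i; i < K\<rbrakk> \<Longrightarrow> F (Suc i) \<le> G i"
    "\<And>i. F i \<le> F 0"
  shows "level_sum B K F \<le> level_sum B K G + 2 * B / real K * F 0"
proof -
  have "(\<Sum>i = 1..<K. F i) \<le> F 0 + (\<Sum>i = 1..<K. F (Suc i))"
  proof -
    have "(\<Sum>i = 1..<Suc n. F i) \<le> F 0 + (\<Sum>i = 1..<Suc n. F (Suc i)) - F (Suc n)" for n
      using assms(7)[of "Suc 0"] by (induction n) auto
    from this[of "K - 1"] show ?thesis
      using assms(2,3) by simp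
  qed
  also have "\<dots> \<le> F 0 + (\<Sum>i = 1..<K. G i)"
    using assms(6) by (auto intro!: sum_mono)
  finally have "2 * B / real K * (\<Sum>i = 1..<K. F i) \<le> 2 * B / real K * (F 0 + (\<Sum>i = 1..<K. G i))"
    using assms(1) by (intro mult_left_mono) auto
  then show ?thesis
    using assms(2-5) by (simp add: level_sum_Abel algebra_simps)
qed

section \<open>Integrals of simple and of continuous functions against a charge\<close>

context finite_charge
begin

lemma simple_integral_superset:
  assumes "finite Y" "g ` T \<subseteq> Y"
  shows "charge_simple_integral T \<nu> g = (\<Sum>y\<in>Y. y * \<nu> (g -` {y} \<inter> T))"
  unfolding charge_simple_integral_def
proof (rule sum.mono_neutral_left[OF assms], rule ballI)
  fix y assume "y \<in> Y - g ` T"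
  then have "g -` {y} \<inter> T = {}" by auto
  then show "y * \<nu> (g -` {y} \<inter> T) = 0" by (simp add: charge_empty)
qed

lemma charge_simple_fibre: "\<lbrakk>charge_simple T g; y \<in> g ` T\<rbrakk> \<Longrightarrow> g -` {y} \<inter> T \<in> open_algebra T"
  unfolding charge_simple_def by blast

lemma sum_charge_fibres:
  assumes "A \<in> open_algebra T" "charge_simple T g"
  shows "(\<Sum>y\<in>g ` T. \<nu> (A \<inter> (g -` {y} \<inter> T))) = \<nu> A"
proof -
  have "A = (\<Union>y\<in>g ` T. A \<inter> (g -` {y} \<inter> T))"
    using sets_into_space[OF assms(1)] by auto
  also have "\<nu> \<dots> = (\<Sum>y\<in>g ` T. \<nu> (A \<inter> (g -` {y} \<inter> T)))"
  proof (rule charge_UN)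
    show "finite (g ` T)"
      using assms(2) by (simp add: charge_simple_def)
    show "A \<inter> (g -` {y} \<inter> T) \<in> open_algebra T" if "y \<in> g ` T" for y
      using assms that by (intro Int charge_simple_fibre)
  qed (auto simp: disjoint_family_on_def)
  finally show ?thesis ..
qed

text \<open>Both integrals are written over the common refinement by the fibres of \<open>g\<close>
  and \<open>h\<close>; a nonempty cell forces \<open>y \<le> z\<close>, and an empty one has mass
  0.\<close>

lemma simple_integral_mono:
  assumes g: "charge_simple T g" and h: "charge_simple T h" and le: "\<And>x. x \<in> T \<Longrightarrow> g x \<le> h x"
  shows "charge_simple_integral T \<nu> g \<le> charge_simple_integral T \<nu> h"
proof -
  define M where "M y z = \<nu> (g -` {y} \<inter> T \<inter> (h -` {z} \<inter> T))" for y z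
  have "charge_simple_integral T \<nu> g = (\<Sum>y\<in>g ` T. \<Sum>z\<in>h ` T. y * M y z)"
    using sum_charge_fibres[OF charge_simple_fibre[OF g] h]
    by (simp add: charge_simple_integral_def M_def sum_distrib_left[symmetric])
  also have "\<dots> \<le> (\<Sum>y\<in>g ` T. \<Sum>z\<in>h ` T. z * M y z)"
  proof (intro sum_mono)
    fix y z assume yz: "y \<in> g ` T" "z \<in> h ` T"
    show "y * M y z \<le> z * M y z"
    proof (cases "g -` {y} \<inter> T \<inter> (h -` {z} \<inter> T) = {}")
      case True
      then show ?thesis by (simp add: M_def charge_empty)
    next
      case False
      then have "y \<le> z" using le by auto
      moreover have "0 \<le> M y z"
        unfolding M_def using yz g h by (intro nonneg Int charge_simple_fibre)
      ultimately show ?thesis by (rule mult_right_mono)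
    qed
  qed
  also have "\<dots> = (\<Sum>z\<in>h ` T. \<Sum>y\<in>g ` T. z * M y z)"
    by (rule sum.swap)
  also have "\<dots> = charge_simple_integral T \<nu> h"
    using sum_charge_fibres[OF charge_simple_fibre[OF h] g]
    by (simp add: charge_simple_integral_def M_def sum_distrib_left[symmetric] Int_commute)
  finally show ?thesis .
qed

text \<open>Injectivity of \<open>t\<close> keeps different layers \<open>A i - A (Suc i)\<close>
  from sharing a value, so the fibres are exactly the layers.\<close>

lemma simple_level:
  assumes A: "antimono A" "A 0 = UNIV" "A K = {}" "\<And>i. A i \<inter> T \<in> open_algebra T" and "inj t"
  shows "charge_simple T (\<lambda>x. t (level A K x))"
    and "charge_simple_integral T \<nu> (\<lambda>x. t (level A K x)) =
      (\<Sum>i<K. t i * (\<nu> (A i \<inter> T) - \<nu> (A (Suc i) \<inter> T)))"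
proof -
  let ?g = "\<lambda>x. t (level A K x)"
  have fibre: "?g -` {t i} \<inter> T = A i \<inter> T - A (Suc i) \<inter> T" if "i < K" for i
  proof (rule set_eqI)
    fix x
    have "t (level A K x) = t i \<longleftrightarrow> x \<in> A i - A (Suc i)"
      using level(4)[OF A(1-3) that] inj_eq[OF \<open>inj t\<close>] by metis
    then show "x \<in> ?g -` {t i} \<inter> T \<longleftrightarrow> x \<in> A i \<inter> T - A (Suc i) \<inter> T"
      by blast
  qed
  have sub: "?g ` T \<subseteq> t ` {..<K}"
    using level(1)[OF A(1-3)] by auto
  have "?g -` {y} \<inter> T \<in> open_algebra T" if "y \<in> ?g ` T" for y
  proof -
    from that sub obtain i where "i < K" "y = t i" by blast
    then show ?thesis
      using fibre A(4) by (simp add: Diff)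
  qed
  then show "charge_simple T ?g"
    using finite_subset[OF sub] by (simp add: charge_simple_def)
  have "charge_simple_integral T \<nu> ?g = (\<Sum>y\<in>t ` {..<K}. y * \<nu> (?g -` {y} \<inter> T))"
    by (rule simple_integral_superset[OF _ sub]) simp
  also have "\<dots> = (\<Sum>i<K. t i * \<nu> (?g -` {t i} \<inter> T))"
    by (simp add: sum.reindex[OF inj_on_subset[OF \<open>inj t\<close> subset_UNIV]])
  also have "\<dots> = (\<Sum>i<K. t i * (\<nu> (A i \<inter> T) - \<nu> (A (Suc i) \<inter> T)))"
  proof (rule sum.cong[OF refl])
    fix i assume "i \<in> {..<K}"
    then have "\<nu> (?g -` {t i} \<inter> T) = \<nu> (A i \<inter> T - A (Suc i) \<inter> T)"
      using fibre by simp
    also have "\<dots> = \<nu> (A i \<inter> T) - \<nu> (A (Suc i) \<inter> T)"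
      using antimonoD[OF A(1), of i "Suc i"] by (intro charge_Diff A(4)) auto
    finally show "t i * \<nu> (?g -` {t i} \<inter> T) = t i * (\<nu> (A i \<inter> T) - \<nu> (A (Suc i) \<inter> T))"
      by simp
  qed
  finally show "charge_simple_integral T \<nu> ?g = (\<Sum>i<K. t i * (\<nu> (A i \<inter> T) - \<nu> (A (Suc i) \<inter> T)))" .
qed

text \<open>Approximation from both sides with vanishing gap makes the lower supremum and the upper
  infimum agree, so the description in \<open>charge_integral\<close> has a unique solution.\<close>

lemma charge_integral_sandwich:
  assumes bdd: "\<And>x. x \<in> T \<Longrightarrow> \<bar>f x\<bar> \<le> B"
    and approx: "\<And>K. \<exists>g h. charge_simple T g \<and> charge_simple T h \<and> (\<forall>x\<in>T. g x \<le> f x \<and> f x \<le> h x) \<and>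
      charge_simple_integral T \<nu> h \<le> charge_simple_integral T \<nu> g + c / real (Suc K)"
  shows charge_integral_lower:
      "\<lbrakk>charge_simple T g; \<And>x. x \<in> T \<Longrightarrow> g x \<le> f x\<rbrakk> \<Longrightarrow> charge_simple_integral T \<nu> g \<le> charge_integral T \<nu> f"
    and charge_integral_upper:
      "\<lbrakk>charge_simple T g; \<And>x. x \<in> T \<Longrightarrow> f x \<le> g x\<rbrakk> \<Longrightarrow> charge_integral T \<nu> f \<le> charge_simple_integral T \<nu> g"
proof -
  let ?L = "{charge_simple_integral T \<nu> g |g. charge_simple T g \<and> (\<forall>x\<in>T. g x \<le> f x)}"
  let ?U = "{charge_simple_integral T \<nu> g |g. charge_simple T g \<and> (\<forall>x\<in>T. f x \<le> g x)}"
  have le: "l \<le> u" if lu: "l \<in> ?L" "u \<in> ?U" for l u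
  proof -
    obtain g h where "l = charge_simple_integral T \<nu> g" "u = charge_simple_integral T \<nu> h"
      "charge_simple T g" "charge_simple T h" "\<And>x. x \<in> T \<Longrightarrow> g x \<le> f x" "\<And>x. x \<in> T \<Longrightarrow> f x \<le> h x"
      using lu by blast
    then show ?thesis
      using simple_integral_mono[of g h] by (metis order_trans)
  qed
  obtain l u where lu: "l \<in> ?L" "u \<in> ?U"
    using approx[of 0] by blast
  have bL: "bdd_above ?L"
    using le lu(2) by (meson bdd_above.I)
  have bU: "bdd_below ?U"
    using le lu(1) by (meson bdd_below.I)
  have "Sup ?L \<le> Inf ?U"
    using le lu by (intro cSup_least cInf_greatest) blast+
  moreover have "Inf ?U - Sup ?L \<le> c / real (Suc K)" for K
  proof -
    obtain g h where gh: "charge_simple T g" "charge_simple T h" "\<forall>x\<in>T. g x \<le> f x \<and> f x \<le> h x"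
      "charge_simple_integral T \<nu> h \<le> charge_simple_integral T \<nu> g + c / real (Suc K)"
      using approx[of K] by blast
    have "charge_simple_integral T \<nu> g \<le> Sup ?L"
      by (rule cSup_upper[OF _ bL]) (use gh in blast)
    moreover have "Inf ?U \<le> charge_simple_integral T \<nu> h"
      by (rule cInf_lower[OF _ bU]) (use gh in blast)
    ultimately show ?thesis using gh(4) by linarith
  qed
  then have "Inf ?U - Sup ?L \<le> 0"
    by (rule nonpos_of_le_divide_Suc)
  ultimately have eq: "Inf ?U = Sup ?L" by linarith
  have "bounded (f ` T)"
    using bdd by (auto simp: bounded_iff)
  then have integral: "charge_integral T \<nu> f = Sup ?L"
    unfolding charge_integral_def has_charge_integral_def using eq by (intro the_equality) auto
  show "charge_simple_integral T \<nu> g \<le> charge_integral T \<nu> f"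
    if "charge_simple T g" "\<And>x. x \<in> T \<Longrightarrow> g x \<le> f x" for g
    unfolding integral by (rule cSup_upper[OF _ bL]) (use that in blast)
  show "charge_integral T \<nu> f \<le> charge_simple_integral T \<nu> g"
    if "charge_simple T g" "\<And>x. x \<in> T \<Longrightarrow> f x \<le> g x" for g
    unfolding integral eq[symmetric] by (rule cInf_lower[OF _ bU]) (use that in blast)
qed

context
  fixes f :: "'a \<Rightarrow> real" and B :: real
  assumes cont: "continuous_on UNIV f" and bound: "\<And>x. \<bar>f x\<bar> < B"
begin

lemma bound_pos: "0 < B"
  using bound[of undefined] by linarith

text \<open>The strict bound on \<open>f\<close> empties the top superlevel set, and continuity
  makes all of them closed, hence members of the algebra.\<close>

lemma superlevel:
  fixes K :: nat
  assumes "0 < K"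
  defines "A \<equiv> \<lambda>i. {x. grid B K i \<le> f x}"
  shows "antimono A" "A 0 = UNIV" "A K = {}" "A i \<inter> T \<in> open_algebra T"
proof -
  show "antimono A"
    using strict_mono_leD[OF grid_strict_mono[OF bound_pos assms(1)]]
    by (force simp: A_def intro!: antimonoI intro: order_trans)
  have range: "- B \<le> f x" "f x < B" for x
    using bound[of x] by linarith+
  show "A 0 = UNIV" "A K = {}"
    using range by (auto simp: A_def grid_0 grid_end[OF assms(1)] not_le)
  have "closed (A i)"
    unfolding A_def by (intro closed_Collect_le cont continuous_on_const)
  then show "A i \<inter> T \<in> open_algebra T"
    by (intro Int_in_open_algebra closed_in_open_algebra)
qed

definition charge_level_sum :: "nat \<Rightarrow> real" where
  "charge_level_sum K = level_sum B K (\<lambda>i. \<nu> ({x. grid B K i \<le> f x} \<inter> T))"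

text \<open>\<open>g\<close> rounds \<open>f\<close> down to the grid and \<open>h\<close> is one
  grid step higher, so their integrals differ by that step times the total mass.\<close>

lemma level_approximation:
  fixes K :: nat
  assumes "0 < K"
  shows "\<exists>g h. charge_simple T g \<and> charge_simple T h \<and> (\<forall>x\<in>T. g x \<le> f x \<and> f x \<le> h x) \<and>
    charge_simple_integral T \<nu> g = charge_level_sum K \<and>
    charge_simple_integral T \<nu> h = charge_level_sum K + 2 * B * \<nu> T / real K"
proof -
  let ?A = "\<lambda>i. {x. grid B K i \<le> f x}" and ?t = "grid B K"
  note A = superlevel[OF assms]
  have inj: "inj ?t" "inj (\<lambda>i. ?t (Suc i))"
    using strict_mono_imp_inj_on[OF grid_strict_mono[OF bound_pos assms]] by (auto simp: inj_def)
  have "charge_simple_integral T \<nu> (\<lambda>x. ?t (Suc (level ?A K x)))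
      = (\<Sum>i<K. ?t (Suc i) * (\<nu> (?A i \<inter> T) - \<nu> (?A (Suc i) \<inter> T)))"
    by (rule simple_level(2)[OF A inj(2)])
  also have "\<dots> = charge_level_sum K + 2 * B / real K * (\<Sum>i<K. \<nu> (?A i \<inter> T) - \<nu> (?A (Suc i) \<inter> T))"
    unfolding charge_level_sum_def level_sum_def sum_distrib_left
    by (simp add: sum.distrib[symmetric] grid_Suc distrib_right)
  also have "\<dots> = charge_level_sum K + 2 * B * \<nu> T / real K"
    using sum_telescope_lessThan[of "\<lambda>i. \<nu> (?A i \<inter> T)" K] A(2,3) by (simp add: charge_empty)
  finally show ?thesis
    using simple_level(1)[OF A inj(1)] simple_level(1)[OF A inj(2)] simple_level(2)[OF A inj(1)]
      level(2,3)[OF A(1-3)]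
    by (intro exI[of _ "\<lambda>x. ?t (level ?A K x)"] exI[of _ "\<lambda>x. ?t (Suc (level ?A K x))"])
      (auto simp: charge_level_sum_def level_sum_def not_le less_imp_le)
qed

lemma level_approximation_Suc:
  "\<exists>g h. charge_simple T g \<and> charge_simple T h \<and> (\<forall>x\<in>T. g x \<le> f x \<and> f x \<le> h x) \<and>
      charge_simple_integral T \<nu> h \<le> charge_simple_integral T \<nu> g + 2 * B * \<nu> T / real (Suc K)"
  using level_approximation[of "Suc K"] by fastforce

lemma simple_le_charge_integral:
  "\<lbrakk>charge_simple T g; \<And>x. x \<in> T \<Longrightarrow> g x \<le> f x\<rbrakk> \<Longrightarrow> charge_simple_integral T \<nu> g \<le> charge_integral T \<nu> f"
  using charge_integral_lower[OF less_imp_le[OF bound] level_approximation_Suc] .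

lemma charge_integral_le_simple:
  "\<lbrakk>charge_simple T g; \<And>x. x \<in> T \<Longrightarrow> f x \<le> g x\<rbrakk> \<Longrightarrow> charge_integral T \<nu> f \<le> charge_simple_integral T \<nu> g"
  using charge_integral_upper[OF less_imp_le[OF bound] level_approximation_Suc] .

lemma charge_integral_bounds:
  assumes "0 < K"
  shows "charge_level_sum K \<le> charge_integral T \<nu> f"
    and "charge_integral T \<nu> f \<le> charge_level_sum K + 2 * B * \<nu> T / real K"
  using level_approximation[OF assms] simple_le_charge_integral charge_integral_le_simple by metis+

end

end


subsection \<open>Integrals against contents\<close>

text \<open>Every regular cover of the closed set \<open>closure Q\<close> contains
  \<open>Q\<close>. This is the counterpart of \<open>inner_mass_le_content\<close> in comparing
  content and charge.\<close>

lemma (in finite_content) content_le_inner_mass: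
  assumes "Q \<in> regular_opens" "closure Q \<subseteq> A"
  shows "l Q \<le> inner_mass A"
proof -
  have "l Q \<le> outer_mass (closure Q)"
    using assms(1) closure_subset by (intro outer_mass_greatest mono) blast+
  also have "\<dots> \<le> inner_mass A"
    using assms(2) by (intro inner_mass_upper) auto
  finally show ?thesis .
qed

lemma finite_content_regular_content:
  assumes "regular_content \<mu>"
  shows "finite_content \<mu>"
proof
  show "0 \<le> \<mu> R" if "R \<in> regular_opens" for R
    using assms that by (simp add: regular_content_def)
  have sum: "\<mu> (regular_Join F) = (\<Sum>R\<in>F. \<mu> R)" if "finite F" "F \<subseteq> regular_opens" "disjoint F" for F
    using assms that unfolding regular_content_def by blast
  fix Q R :: "'a set" assume QR: "Q \<in> regular_opens" "R \<in> regular_opens" "Q \<inter> R = {}"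
  have "\<mu> {} = 0"
    using sum[of "{}"] by (simp add: regular_Join_empty)
  moreover have "\<mu> (regular_join Q R) = (\<Sum>R\<in>{Q, R}. \<mu> R)"
    using sum[of "{Q, R}"] QR by (simp add: regular_Join_def regular_join_def pairwise_insert disjnt_def Int_commute)
  \<comment> \<open>If \<open>Q = R\<close> the family collapses to one set, which disjointness
    forces to be empty.\<close>
  ultimately show "\<mu> (regular_join Q R) = \<mu> Q + \<mu> R"
    using QR by (cases "Q = R") (auto simp: regular_join_def)
qed

text \<open>Distributivity of the Boolean algebra in topological form: an open \<open>R\<close>
  meets the closure of \<open>X\<close> only inside the closure of
  \<open>X \<inter> R\<close>.\<close>

lemma interior_closure_Int:
  assumes "R \<in> regular_opens"
  shows "interior (closure (X \<inter> R)) = interior (closure X) \<inter> R"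
proof
  show "interior (closure (X \<inter> R)) \<subseteq> interior (closure X) \<inter> R"
    by (metis assms Int_lower1 Int_lower2 closure_mono interior_mono le_inf_iff regular_opens_iff)
  have "interior (closure X) \<inter> R \<subseteq> closure (X \<inter> R)"
    using open_Int_closure_subset[of R X] interior_subset[of "closure X"] regular_opens_open[OF assms]
    by (auto simp: Int_commute)
  then show "interior (closure X) \<inter> R \<subseteq> interior (closure (X \<inter> R))"
    using regular_opens_open[OF assms] by (simp add: interior_maximal open_Int)
qed

lemma (in finite_content) finite_content_Int:
  assumes "R \<in> regular_opens"
  shows "finite_content (\<lambda>Q. l (Q \<inter> R))"
proof
  show "0 \<le> l (Q \<inter> R)" if "Q \<in> regular_opens" for Q
    using that assms by (intro nonneg Int_in_regular_opens)
  fix P Q :: "'a set" assume PQ: "P \<in> regular_opens" "Q \<in> regular_opens" "P \<inter> Q = {}"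
  have "regular_join P Q \<inter> R = regular_join (P \<inter> R) (Q \<inter> R)"
    unfolding regular_join_def using interior_closure_Int[OF assms, of "P \<union> Q"]
    by (simp only: Int_Un_distrib2)
  then show "l (regular_join P Q \<inter> R) = l (P \<inter> R) + l (Q \<inter> R)"
    using join[of "P \<inter> R" "Q \<inter> R"] PQ assms by (auto simp: Int_in_regular_opens)
qed

section \<open>Simple functions and sums over the layers of a regular chain\<close>

lemma sum_regular_partition:
  fixes \<mu> :: "'a::t4_space set \<Rightarrow> real"
  assumes \<mu>: "regular_content \<mu>" and P: "regular_partition P" and R: "R \<in> regular_opens"
  shows "(\<Sum>p\<in>P. \<mu> (p \<inter> R)) = \<mu> R"
proof -
  let ?F = "(\<lambda>p. p \<inter> R) ` P"
  have "regular_Join ?F = regular_Join P \<inter> R"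
    using interior_closure_Int[OF R, of "\<Union>P"] by (simp add: regular_Join_def Int_commute)
  also have "\<dots> = R"
    using P by (simp add: regular_partition_def)
  finally have "\<mu> R = (\<Sum>p\<in>?F. \<mu> p)"
  proof -
    assume "regular_Join ?F = R"
    moreover have "finite ?F" "?F \<subseteq> regular_opens" "disjoint ?F"
      using P R by (auto simp: regular_partition_def disjoint_def Int_in_regular_opens)
    ultimately show ?thesis
      using \<mu> unfolding regular_content_def by metis
  qed
  also have "\<dots> = (\<Sum>p\<in>P. \<mu> (p \<inter> R))"
  proof (subst sum.reindex_nontrivial)
    show "finite P"
      using P by (simp add: regular_partition_def)
    \<comment> \<open>Different cells may leave the same trace on \<open>R\<close>, but by
      disjointness only the empty one, of mass 0.\<close>
    fix p q assume "p \<in> P" "q \<in> P" "p \<noteq> q" "p \<inter> R = q \<inter> R"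
    then have "p \<inter> R = {}"
      using P unfolding regular_partition_def disjoint_def by blast
    then show "\<mu> (p \<inter> R) = 0"
      using finite_content.empty[OF finite_content_regular_content[OF \<mu>]] by simp
  qed simp
  finally show ?thesis ..
qed

text \<open>The cells are refined by the layers \<open>Q i - closure (Q (Suc i))\<close>. On a
  nonempty piece \<open>r p = g x \<le> f x \<le> t i\<close>; summing over the cells first then
  leaves the masses of the layers.\<close>

lemma simple_sum_le:
  fixes \<mu> :: "'a::t4_space set \<Rightarrow> real"
  assumes \<mu>: "regular_content \<mu>" and R: "R \<in> regular_opens"
    and simple: "simple_with P r g" and le: "\<And>x. x \<in> R \<Longrightarrow> g x \<le> f x"
    and Q: "\<And>i. Q i \<in> regular_opens" "antimono Q" "Q 0 = UNIV" "Q K = {}"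
    and bound: "\<And>i x. \<lbrakk>i < K; x \<notin> Q (Suc i)\<rbrakk> \<Longrightarrow> f x \<le> t i"
  shows "(\<Sum>p\<in>P. r p * \<mu> (p \<inter> R)) \<le> (\<Sum>i<K. t i * (\<mu> (Q i \<inter> R) - \<mu> (Q (Suc i) \<inter> R)))"
proof -
  interpret \<mu>: finite_content \<mu>
    using \<mu> by (rule finite_content_regular_content)
  let ?c = "\<lambda>i. Q i - closure (Q (Suc i))"
  have P: "regular_partition P"
    using simple by (simp add: simple_with_def)
  then have P_regular: "p \<in> regular_opens" if "p \<in> P" for p
    using that unfolding regular_partition_def by blast
  have c: "?c i \<in> regular_opens" for i
    by (intro Diff_closure_in_regular_opens Q)
  have mass: "\<mu> (?c i \<inter> S) = \<mu> (Q i \<inter> S) - \<mu> (Q (Suc i) \<inter> S)" if "S \<in> regular_opens" for S i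
    by (rule finite_content.Diff_closure[OF \<mu>.finite_content_Int[OF that] Q(1) Q(1) antimonoD[OF Q(2)]]) simp
  have "(\<Sum>p\<in>P. r p * \<mu> (p \<inter> R)) = (\<Sum>p\<in>P. \<Sum>i<K. r p * \<mu> (?c i \<inter> (p \<inter> R)))"
  proof (rule sum.cong[OF refl])
    fix p assume "p \<in> P"
    then have "p \<inter> R \<in> regular_opens"
      using R by (simp add: Int_in_regular_opens P_regular)
    then have "(\<Sum>i<K. \<mu> (?c i \<inter> (p \<inter> R))) = \<mu> (p \<inter> R)"
      using sum_telescope_lessThan[of "\<lambda>i. \<mu> (Q i \<inter> (p \<inter> R))" K] Q(3,4) by (simp add: mass \<mu>.empty)
    then show "r p * \<mu> (p \<inter> R) = (\<Sum>i<K. r p * \<mu> (?c i \<inter> (p \<inter> R)))"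
      by (simp add: sum_distrib_left[symmetric])
  qed
  also have "\<dots> \<le> (\<Sum>p\<in>P. \<Sum>i<K. t i * \<mu> (p \<inter> (?c i \<inter> R)))"
  proof (intro sum_mono)
    fix p i assume pi: "p \<in> P" "i \<in> {..<K}"
    have eq: "p \<inter> (?c i \<inter> R) = ?c i \<inter> (p \<inter> R)"
      by auto
    show "r p * \<mu> (?c i \<inter> (p \<inter> R)) \<le> t i * \<mu> (p \<inter> (?c i \<inter> R))"
    proof (cases "?c i \<inter> (p \<inter> R) = {}")
      case True
      then show ?thesis
        unfolding eq by (simp only: \<mu>.empty)
    next
      case False
      then obtain x where x: "x \<in> ?c i" "x \<in> p" "x \<in> R" by blast
      have "x \<notin> Q (Suc i)"
        using x(1) closure_subset by auto
      then have "f x \<le> t i"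
        using bound pi(2) by auto
      moreover have "r p = g x"
        using simple pi(1) x(2) by (simp add: simple_with_def)
      moreover have "0 \<le> \<mu> (?c i \<inter> (p \<inter> R))"
        by (intro \<mu>.nonneg Int_in_regular_opens c R P_regular[OF pi(1)])
      ultimately show ?thesis
        unfolding eq using le[OF x(3)] by (intro mult_right_mono) auto
    qed
  qed
  also have "\<dots> = (\<Sum>i<K. \<Sum>p\<in>P. t i * \<mu> (p \<inter> (?c i \<inter> R)))"
    by (rule sum.swap)
  also have "\<dots> = (\<Sum>i<K. t i * (\<mu> (Q i \<inter> R) - \<mu> (Q (Suc i) \<inter> R)))"
    using sum_regular_partition[OF \<mu> P Int_in_regular_opens[OF c R]] mass[OF R]
    by (simp add: sum_distrib_left[symmetric])
  finally show ?thesis .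
qed

text \<open>The layers \<open>c i\<close> form a regular partition, and the level function is
  constant on each of them.\<close>

lemma simple_level_exists:
  fixes \<mu> :: "'a::t4_space set \<Rightarrow> real"
  assumes \<mu>: "regular_content \<mu>" and R: "R \<in> regular_opens"
    and Q: "\<And>i. Q i \<in> regular_opens" "antimono Q" "Q 0 = UNIV" "Q K = {}"
  obtains P r where "simple_with P r (\<lambda>x. t (level Q K x))"
    "(\<Sum>p\<in>P. r p * \<mu> (p \<inter> R)) = (\<Sum>i<K. t i * (\<mu> (Q i \<inter> R) - \<mu> (Q (Suc i) \<inter> R)))"
proof -
  interpret \<mu>: finite_content \<mu>
    using \<mu> by (rule finite_content_regular_content)
  define c where "c i = Q i - closure (Q (Suc i))" for i
  let ?h = "\<lambda>x. t (level Q K x)"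
  \<comment> \<open>Values are attached to cells, not to indices, so a point of the cell is chosen;
    on an empty cell the value is arbitrary and its mass is 0.\<close>
  define r where "r p = ?h (SOME x. x \<in> p)" for p
  have c: "c i \<in> regular_opens" for i
    unfolding c_def by (intro Diff_closure_in_regular_opens Q)
  have level_c: "level Q K x = i" if "i < K" "x \<in> c i" for i x
    using level(4)[OF Q(2-4) that(1)] that(2) closure_subset[of "Q (Suc i)"] by (auto simp: c_def)
  have "regular_partition (c ` {..<K})"
    unfolding regular_partition_def
  proof (intro conjI)
    show "disjoint (c ` {..<K})"
    proof (rule disjointI)
      fix p q assume "p \<in> c ` {..<K}" "q \<in> c ` {..<K}" "p \<noteq> q"
      then obtain i j where "i < K" "j < K" "p = c i" "q = c j" "i \<noteq> j" by auto
      then show "p \<inter> q = {}"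
        using level_c[of i] level_c[of j] by blast
    qed
    let ?W = "- closure (\<Union> (c ` {..<K}))"
    have W: "?W \<inter> c i = {}" if "i < K" for i
      using that closure_subset[of "\<Union> (c ` {..<K})"] by blast
    have "?W \<inter> Q 0 = {}"
    \<comment> \<open>Density of the layers, by descent from \<open>K\<close>: an open set missing
      \<open>Q (Suc i)\<close> also misses its closure, and with the layer \<open>c i\<close> it
      misses \<open>Q i\<close>.\<close>
    proof (rule inc_induct[of 0 K])
      fix i assume i: "i < K" and "?W \<inter> Q (Suc i) = {}"
      then have "?W \<inter> closure (Q (Suc i)) = {}"
        using open_Int_closure_eq_empty[of ?W "Q (Suc i)"] by blast
      then show "?W \<inter> Q i = {}"
        using W[OF i] by (auto simp: c_def)
    qed (simp_all add: Q(4))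
    then have "closure (\<Union> (c ` {..<K})) = UNIV"
      using Q(3) by auto
    then show "regular_Join (c ` {..<K}) = UNIV"
      by (simp only: regular_Join_def interior_UNIV)
  qed (use c in auto)
  moreover have r: "?h x = r (c i)" if "i < K" "x \<in> c i" for i x
    unfolding r_def using level_c that someI[of "\<lambda>x. x \<in> c i" x] by metis
  ultimately have "simple_with (c ` {..<K}) r ?h"
    by (auto simp: simple_with_def)
  moreover have "(\<Sum>p\<in>c ` {..<K}. r p * \<mu> (p \<inter> R)) = (\<Sum>i<K. r (c i) * \<mu> (c i \<inter> R))"
  proof (subst sum.reindex_nontrivial)
    fix i j assume "i \<in> {..<K}" "j \<in> {..<K}" "i \<noteq> j" "c i = c j"
    then have "c i = {}"
      using level_c by (metis equals0I lessThan_iff)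
    then show "r (c i) * \<mu> (c i \<inter> R) = 0"
      by (simp add: \<mu>.empty)
  qed simp_all
  moreover have "r (c i) * \<mu> (c i \<inter> R) = t i * (\<mu> (Q i \<inter> R) - \<mu> (Q (Suc i) \<inter> R))" if "i < K" for i
  proof -
    have "\<mu> (c i \<inter> R) = \<mu> (Q i \<inter> R) - \<mu> (Q (Suc i) \<inter> R)"
      unfolding c_def
      by (rule finite_content.Diff_closure[OF \<mu>.finite_content_Int[OF R] Q(1) Q(1) antimonoD[OF Q(2)]]) simp
    moreover have "r (c i) = t i \<or> c i = {}"
      using r level_c that by (metis equals0I)
    ultimately show ?thesis
      using \<mu>.empty by auto
  qed
  ultimately show thesis
    using that by simp
qed


text \<open>
  The content and the charge are compared through the regular sets \<open>interior (closure {t < f})\<close>,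
  which lie between the open set \<open>{t < f}\<close> and the closed set \<open>{t \<le> f}\<close>.
\<close>

locale content_integrand =
  fixes \<mu> :: "'a::t4_space set \<Rightarrow> real" and R :: "'a set" and f :: "'a \<Rightarrow> real" and B :: real
  assumes \<mu>: "regular_content \<mu>" and R: "R \<in> regular_opens"
    and cont: "continuous_on UNIV f" and bound: "\<And>x. \<bar>f x\<bar> < B"
begin

definition Q :: "nat \<Rightarrow> nat \<Rightarrow> 'a set" where
  "Q K i = interior (closure {x. grid B K i < f x})"

lemma range: "- B < f x" "f x < B" and B_pos: "0 < B"
  using bound[of x] by linarith+

lemma Q_regular: "Q K i \<in> regular_opens"
  unfolding Q_def by (rule interior_closure_in_regular_opens)

lemma closure_Q_subset: "closure (Q K i) \<subseteq> {x. grid B K i \<le> f x}"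
proof -
  have "closed {x. grid B K i \<le> f x}"
    by (intro closed_Collect_le cont continuous_on_const)
  then have "closure {x. grid B K i < f x} \<subseteq> {x. grid B K i \<le> f x}"
    by (intro closure_minimal) auto
  then show ?thesis
    unfolding Q_def by (meson closure_closure closure_mono interior_subset order_trans closed_closure closure_minimal)
qed

lemma Q_subset: "Q K i \<subseteq> {x. grid B K i \<le> f x}"
  using closure_Q_subset closure_subset by blast

lemma subset_Q: "{x. grid B K i < f x} \<subseteq> Q K i"
  unfolding Q_def
  by (intro interior_maximal closure_subset open_Collect_less cont continuous_on_const)

context
  fixes K :: nat
  assumes K: "0 < K"
begin

lemma grid_mono: "i \<le> j \<Longrightarrow> grid B K i \<le> grid B K j"
  using strict_mono_leD[OF grid_strict_mono[OF B_pos K]] .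

lemma Q_antimono: "antimono (Q K)"
proof (rule antimonoI)
  fix i j :: nat assume "i \<le> j"
  then have "{x. grid B K j < f x} \<subseteq> {x. grid B K i < f x}"
    using grid_mono[of i j] by auto
  then show "Q K j \<subseteq> Q K i"
    unfolding Q_def by (intro interior_mono closure_mono)
qed

lemma Q_0: "Q K 0 = UNIV" and Q_end: "Q K K = {}"
proof -
  have "{x. - B < f x} = UNIV" "{x. B < f x} = {}"
    using range less_asym by blast+
  then show "Q K 0 = UNIV" "Q K K = {}"
    by (simp_all add: Q_def grid_0 grid_end[OF K])
qed

definition content_level_sum :: real where
  "content_level_sum = level_sum B K (\<lambda>i. \<mu> (Q K i \<inter> R))"

text \<open>From below, the level function is itself an admissible simple function. From above, off
  \<open>Q K (Suc i)\<close> the function is at most the next grid point, which costs one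
  step.\<close>

lemma content_integral_bounds:
  shows "content_level_sum \<le> content_integral R \<mu> f"
    and "content_integral R \<mu> f \<le> content_level_sum + 2 * B / real K * \<mu> R"
proof -
  note \<mu>_empty = finite_content.empty[OF finite_content_regular_content[OF \<mu>]]
  note Qs = Q_regular Q_antimono Q_0 Q_end
  let ?S = "{(\<Sum>p\<in>P. r p * \<mu> (p \<inter> R)) |P r g. simple_with P r g \<and> bounded (range g) \<and> (\<forall>x\<in>R. g x \<le> f x)}"
  let ?h = "\<lambda>x. grid B K (level (Q K) K x)"
  have upper: "s \<le> content_level_sum + 2 * B / real K * \<mu> R" if "s \<in> ?S" for s
  proof -
    from that obtain P r g where s: "s = (\<Sum>p\<in>P. r p * \<mu> (p \<inter> R))" "simple_with P r g" "\<forall>x\<in>R. g x \<le> f x"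
      by blast
    have "s \<le> (\<Sum>i<K. grid B K (Suc i) * (\<mu> (Q K i \<inter> R) - \<mu> (Q K (Suc i) \<inter> R)))"
      unfolding s(1)
    proof (rule simple_sum_le[OF \<mu> R s(2) _ Qs])
      show "f x \<le> grid B K (Suc i)" if "x \<notin> Q K (Suc i)" for x i
        using that subset_Q[of K "Suc i"] by (auto simp: not_less[symmetric])
    qed (use s(3) in auto)
    also have "\<dots> = content_level_sum + 2 * B / real K * (\<Sum>i<K. \<mu> (Q K i \<inter> R) - \<mu> (Q K (Suc i) \<inter> R))"
      unfolding content_level_sum_def level_sum_def sum_distrib_left
      by (simp add: sum.distrib[symmetric] grid_Suc distrib_right)
    also have "\<dots> = content_level_sum + 2 * B / real K * \<mu> R"
      using sum_telescope_lessThan[of "\<lambda>i. \<mu> (Q K i \<inter> R)" K] Q_0 Q_end \<mu>_empty by simp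
    finally show ?thesis .
  qed
  obtain P r where Pr: "simple_with P r ?h" "(\<Sum>p\<in>P. r p * \<mu> (p \<inter> R)) = content_level_sum"
    unfolding content_level_sum_def level_sum_def by (rule simple_level_exists[OF \<mu> R Qs])
  have "range ?h \<subseteq> grid B K ` {..<K}"
    by (intro image_subsetI imageI) (simp add: level(1)[OF Qs(2-4)])
  then have "bounded (range ?h)"
    by (meson bounded_subset finite_imageI finite_imp_bounded finite_lessThan)
  moreover have "?h x \<le> f x" for x
    using level(2)[OF Qs(2-4), of x] Q_subset[of K "level (Q K) K x"] by blast
  ultimately have mem: "content_level_sum \<in> ?S"
    using Pr(1) Pr(2)[symmetric] by blast
  show "content_level_sum \<le> content_integral R \<mu> f"
    unfolding content_integral_def by (rule cSup_upper[OF mem]) (use upper in \<open>meson bdd_above.I\<close>)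
  show "content_integral R \<mu> f \<le> content_level_sum + 2 * B / real K * \<mu> R"
    unfolding content_integral_def by (rule cSup_least) (use mem upper in blast)+
qed

end

end

text \<open>The charge representing the functional \<open>content_integral R \<mu>\<close>.\<close>

definition content_charge :: "('a::t4_space set \<Rightarrow> real) \<Rightarrow> 'a set \<Rightarrow> 'a set \<Rightarrow> real" where
  "content_charge \<mu> R = finite_content.associated_charge (\<lambda>Q. \<mu> (Q \<inter> R))"

lemma finite_content_Int_regular_content:
  "regular_content \<mu> \<Longrightarrow> R \<in> regular_opens \<Longrightarrow> finite_content (\<lambda>Q. \<mu> (Q \<inter> R))"
  by (rule finite_content.finite_content_Int[OF finite_content_regular_content])

lemma normal_charge_content_charge:
  assumes "regular_content \<mu>" "R \<in> regular_opens"
  shows "normal_charge UNIV (content_charge \<mu> R)"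
  unfolding content_charge_def
proof (rule finite_content.normal_charge_associated_charge[OF finite_content_Int_regular_content[OF assms]])
  have "\<mu> R \<le> \<mu> UNIV"
    using finite_content.mono[OF finite_content_regular_content[OF assms(1)]] assms(2) by simp
  then show "\<mu> (UNIV \<inter> R) \<le> 1"
    using assms(1) by (simp add: regular_content_def)
qed

text \<open>The masses interlace: the content of \<open>Q K i\<close> lies between the charges of
  the closed superlevel sets at indices \<open>Suc i\<close> and \<open>i\<close>. The two level
  sums thus differ by at most one grid step times the mass.\<close>

lemma content_integral_eq_charge_integral:
  fixes \<mu> :: "'a::t4_space set \<Rightarrow> real"
  assumes \<mu>: "regular_content \<mu>" and R: "R \<in> regular_opens" and f: "f \<in> bcontfun"
  shows "content_integral R \<mu> f = charge_integral UNIV (content_charge \<mu> R) f"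
proof -
  have cont: "continuous_on UNIV f" and "bounded (range f)"
    using f by (auto simp: bcontfun_def)
  then obtain B where "\<And>x. \<bar>f x\<bar> < B"
    unfolding bounded_pos_less by auto
  then interpret content_integrand \<mu> R f B
    by unfold_locales (use \<mu> R cont in auto)
  define \<nu> where "\<nu> = content_charge \<mu> R"
  interpret l: finite_content "\<lambda>Q. \<mu> (Q \<inter> R)"
    by (rule finite_content_Int_regular_content[OF \<mu> R])
  have "charge UNIV \<nu>"
    using normal_charge_content_charge[OF \<mu> R] by (simp add: \<nu>_def normal_charge_def)
  then interpret \<nu>: finite_charge UNIV \<nu>
    by (rule finite_charge_of_charge)
  have \<nu>_inner: "\<nu> A = l.inner_mass A" if "A \<in> open_algebra UNIV" for A
    using that by (simp add: \<nu>_def content_charge_def l.associated_charge_eq)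
  have \<nu>_UNIV: "\<nu> UNIV = \<mu> R"
    using \<nu>_inner[OF \<nu>.top] by (simp add: l.inner_mass_UNIV)
  let ?c = "content_integral R \<mu> f" and ?i = "charge_integral UNIV \<nu> f"
  \<comment> \<open>The constant 4 stands for two grid steps, one from shifting the index and one
    from rounding \<open>f\<close>.\<close>
  have bounds: "?c - ?i \<le> 4 * B * \<mu> R / real K" "?i - ?c \<le> 4 * B * \<mu> R / real K" if K: "0 < K" for K
  proof -
    let ?F = "\<lambda>i. \<nu> ({x. grid B K i \<le> f x} \<inter> UNIV)" and ?G = "\<lambda>i. \<mu> (Q K i \<inter> R)"
    note superlevel = \<nu>.superlevel[OF cont bound K]
    have ends: "?F K = 0" "?G K = 0" "?F 0 = ?G 0"
      using superlevel(2,3) Q_0[OF K] Q_end[OF K] \<nu>_UNIV \<nu>.charge_empty l.empty by simp_all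
    have FG: "?G i \<le> ?F i" for i
      using l.content_le_inner_mass[OF Q_regular closure_Q_subset] \<nu>_inner superlevel(4) by simp
    have GF: "?F (Suc i) \<le> ?G i" for i
    proof -
      have "grid B K i < grid B K (Suc i)"
        using grid_strict_mono[OF B_pos K] by (simp add: strict_mono_def)
      then have "{x. grid B K (Suc i) \<le> f x} \<subseteq> Q K i"
        using subset_Q[of K i] by auto
      then show ?thesis
        using l.inner_mass_le_content[OF Q_regular] \<nu>_inner superlevel(4) by simp
    qed
    have "?F i \<le> ?F 0" for i
      using superlevel(2,4) by (intro \<nu>.charge_mono) auto
    then have "level_sum B K ?F \<le> level_sum B K ?G + 2 * B / real K * ?F 0"
      using B_pos K ends GF by (intro level_sum_shift) auto
    moreover have "?F 0 = \<mu> R"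
      using superlevel(2) \<nu>_UNIV by simp
    ultimately have "level_sum B K ?F \<le> level_sum B K ?G + 2 * B / real K * \<mu> R"
      by (simp only:)
    moreover have "level_sum B K ?G \<le> level_sum B K ?F"
      using B_pos K ends FG by (intro level_sum_mono) auto
    moreover have "0 \<le> \<mu> R"
      using \<nu>_UNIV \<nu>.nonneg[OF \<nu>.top] by simp
    moreover from this have "0 \<le> 2 * B / real K * \<mu> R" "4 * B * \<mu> R / real K = 2 * (2 * B / real K * \<mu> R)"
      "2 * B * \<mu> R / real K = 2 * B / real K * \<mu> R"
      using B_pos by simp_all
    ultimately show "?c - ?i \<le> 4 * B * \<mu> R / real K" "?i - ?c \<le> 4 * B * \<mu> R / real K"
      using content_integral_bounds[OF K] \<nu>.charge_integral_bounds[OF cont bound K]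
      unfolding content_level_sum_def[OF K] \<nu>.charge_level_sum_def[OF cont bound] \<nu>_UNIV
      by linarith+
  qed
  have "?c - ?i \<le> 0" "?i - ?c \<le> 0"
    by (rule nonpos_of_le_divide_Suc[OF bounds(1)[OF zero_less_Suc]]
        nonpos_of_le_divide_Suc[OF bounds(2)[OF zero_less_Suc]])+
  then show ?thesis
    unfolding \<nu>_def by linarith
qed


subsection \<open>Uniqueness of normal charges\<close>

text \<open>Level sums are linear in the masses, so they add over the two pieces, and the integrals
  follow in the limit of fine grids.\<close>

lemma charge_integral_glue:
  fixes \<nu> \<nu>1 \<nu>2 :: "'a::topological_space set \<Rightarrow> real"
  assumes \<nu>: "finite_charge UNIV \<nu>" and \<nu>1: "finite_charge S \<nu>1" and \<nu>2: "finite_charge T \<nu>2"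
    and glue: "\<And>A. A \<in> open_algebra UNIV \<Longrightarrow> \<nu> A = \<nu>1 (A \<inter> S) + \<nu>2 (A \<inter> T)"
    and f: "f \<in> bcontfun"
  shows "charge_integral UNIV \<nu> f = charge_integral S \<nu>1 f + charge_integral T \<nu>2 f"
proof -
  have cont: "continuous_on UNIV f" and "bounded (range f)"
    using f by (auto simp: bcontfun_def)
  then obtain B where bound: "\<And>x. \<bar>f x\<bar> < B"
    unfolding bounded_pos_less by auto
  interpret \<nu>: finite_charge UNIV \<nu> by (rule \<nu>)
  interpret \<nu>1: finite_charge S \<nu>1 by (rule \<nu>1)
  interpret \<nu>2: finite_charge T \<nu>2 by (rule \<nu>2)
  let ?i = "charge_integral UNIV \<nu> f" and ?j = "charge_integral S \<nu>1 f + charge_integral T \<nu>2 f"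
  have total: "\<nu> UNIV = \<nu>1 S + \<nu>2 T"
    using glue[OF \<nu>.top] by simp
  have bounds: "?i - ?j \<le> 2 * B * \<nu> UNIV / real K" "?j - ?i \<le> 2 * B * \<nu> UNIV / real K" if K: "0 < K" for K
  proof -
    have "{x. grid B K i \<le> f x} \<in> open_algebra UNIV" for i
      by (intro closed_in_open_algebra closed_Collect_le cont continuous_on_const)
    then have "\<nu>.charge_level_sum f B K = \<nu>1.charge_level_sum f B K + \<nu>2.charge_level_sum f B K"
      unfolding \<nu>.charge_level_sum_def[OF cont bound] \<nu>1.charge_level_sum_def[OF cont bound]
        \<nu>2.charge_level_sum_def[OF cont bound] level_sum_add[symmetric]
      by (simp add: glue)
    moreover have "2 * B * \<nu> UNIV / real K = 2 * B * \<nu>1 S / real K + 2 * B * \<nu>2 T / real K"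
      by (simp add: total distrib_left add_divide_distrib)
    ultimately show "?i - ?j \<le> 2 * B * \<nu> UNIV / real K" "?j - ?i \<le> 2 * B * \<nu> UNIV / real K"
      using \<nu>.charge_integral_bounds[OF cont bound K] \<nu>1.charge_integral_bounds[OF cont bound K]
        \<nu>2.charge_integral_bounds[OF cont bound K] by linarith+
  qed
  have "?i - ?j \<le> 0" "?j - ?i \<le> 0"
    by (rule nonpos_of_le_divide_Suc[OF bounds(1)[OF zero_less_Suc]]
        nonpos_of_le_divide_Suc[OF bounds(2)[OF zero_less_Suc]])+
  then show ?thesis by linarith
qed

lemma finite_charge_of_normal_charge: "normal_charge T \<nu> \<Longrightarrow> finite_charge T \<nu>"
  by (rule finite_charge_of_charge) (rule normal_charge_def[THEN iffD1, THEN conjunct1])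

text \<open>Translates the type class into the abstract topology in which
  \<open>Urysohn_lemma\<close> is stated.\<close>

lemma normal_space_euclidean: "normal_space (euclidean :: 'a::t4_space topology)"
  unfolding normal_space_def
proof (intro allI impI)
  fix S T :: "'a set"
  assume "closedin euclidean S \<and> closedin euclidean T \<and> disjnt S T"
  then obtain U V where "open U" "open V" "S \<subseteq> U" "T \<subseteq> V" "U \<inter> V = {}"
    using t4_space[of S T] by (auto simp: disjnt_def)
  then show "\<exists>U V. openin euclidean U \<and> openin euclidean V \<and> S \<subseteq> U \<and> T \<subseteq> V \<and> disjnt U V"
    by (auto simp: disjnt_def)
qed

text \<open>Urysohn functions squeeze the value on a closed set between integrals.\<close>

lemma normal_charge_le:
  fixes \<nu>1 \<nu>2 :: "'a::t4_space set \<Rightarrow> real"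
  assumes \<nu>1: "normal_charge UNIV \<nu>1" and \<nu>2: "normal_charge UNIV \<nu>2"
    and integrals: "\<And>f. f \<in> bcontfun \<Longrightarrow> charge_integral UNIV \<nu>1 f = charge_integral UNIV \<nu>2 f"
    and A: "A \<in> open_algebra UNIV"
  shows "\<nu>1 A \<le> \<nu>2 A"
proof -
  interpret \<nu>1: finite_charge UNIV \<nu>1
    using \<nu>1 by (rule finite_charge_of_normal_charge)
  interpret \<nu>2: finite_charge UNIV \<nu>2
    using \<nu>2 by (rule finite_charge_of_normal_charge)
  have indicator: "charge_simple UNIV (indicator D)"
    "finite_charge UNIV \<nu> \<Longrightarrow> charge_simple_integral UNIV \<nu> (indicator D) = \<nu> D"
    if "D \<in> open_algebra UNIV" for D :: "'a set" and \<nu>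
  proof -
    have fibre: "(indicator D :: 'a \<Rightarrow> real) -` {y} = (if y = 1 then D else if y = 0 then - D else {})" for y
      by (auto simp: indicator_def)
    have sub: "range (indicator D :: 'a \<Rightarrow> real) \<subseteq> {0, 1}"
      by (auto simp: indicator_def)
    then show "charge_simple UNIV (indicator D)"
      using that \<nu>1.compl_sets[OF that] finite_subset[OF sub]
      by (simp add: charge_simple_def fibre Compl_eq_Diff_UNIV)
    show "charge_simple_integral UNIV \<nu> (indicator D) = \<nu> D" if "finite_charge UNIV \<nu>"
      using finite_charge.simple_integral_superset[OF that _ sub] by (simp add: fibre)
  qed
  have closed_le_open: "\<nu>1 C \<le> \<nu>2 U" if "closed C" "open U" "C \<subseteq> U" for C U
  proof -
    have "closedin euclidean C" "closedin euclidean (- U)" "disjnt C (- U)"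
      using that by (auto simp: disjnt_def)
    then obtain f where f: "continuous_map euclidean (top_of_set {0..1::real}) f"
        "f ` (- U) \<subseteq> {0}" "f ` C \<subseteq> {1}"
      by (metis Urysohn_lemma normal_space_euclidean disjnt_sym zero_le_one)
    then have cont: "continuous_on UNIV f" and f01: "\<And>x. 0 \<le> f x" "\<And>x. f x \<le> 1"
      by (auto simp: continuous_map_in_subtopology image_subset_iff)
    \<comment> \<open>The integral estimates ask for a strict bound, and \<open>f\<close> may attain
      1.\<close>
    have bound: "\<bar>f x\<bar> < 2" for x
      using f01[of x] by linarith
    have "range f \<subseteq> {0..1}"
      using f01 by auto
    then have bcont: "f \<in> bcontfun"
      using cont by (auto simp: bcontfun_def intro: bounded_subset bounded_closed_interval)
    have C: "C \<in> open_algebra UNIV" and U: "U \<in> open_algebra UNIV"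
      using that by (simp_all add: closed_in_open_algebra open_in_open_algebra)
    have "indicator C x \<le> f x" "f x \<le> indicator U x" for x
      using f01 f(2,3) by (auto simp: indicator_def)
    then have "\<nu>1 C \<le> charge_integral UNIV \<nu>1 f" "charge_integral UNIV \<nu>2 f \<le> \<nu>2 U"
      using \<nu>1.simple_le_charge_integral[OF cont bound indicator(1)[OF C]]
        \<nu>2.charge_integral_le_simple[OF cont bound indicator(1)[OF U]]
        indicator(2)[OF C \<nu>1.finite_charge_axioms] indicator(2)[OF U \<nu>2.finite_charge_axioms] by auto
    then show ?thesis
      using integrals[OF bcont] by linarith
  qed
  show ?thesis
  proof (rule field_le_epsilon)
    fix e :: real assume "0 < e"
    then have e: "0 < e / 2" by simp
    obtain C where C: "C \<subseteq> A" "closedin (top_of_set UNIV) C" "\<nu>1 A - e / 2 < \<nu>1 C"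
      by (rule normal_charge_inner[OF \<nu>1 A e])
    obtain U where U: "A \<subseteq> U" "openin (top_of_set UNIV) U" "\<nu>2 U < \<nu>2 A + e / 2"
      by (rule normal_charge_outer[OF \<nu>2 A e])
    have "\<nu>1 C \<le> \<nu>2 U"
      using C U by (intro closed_le_open) auto
    then show "\<nu>1 A \<le> \<nu>2 A + e"
      using C(3) U(3) by linarith
  qed
qed

lemma normal_charge_unique:
  fixes \<nu>1 \<nu>2 :: "'a::t4_space set \<Rightarrow> real"
  assumes "normal_charge UNIV \<nu>1" "normal_charge UNIV \<nu>2"
    and "\<And>f. f \<in> bcontfun \<Longrightarrow> charge_integral UNIV \<nu>1 f = charge_integral UNIV \<nu>2 f"
  shows "\<nu>1 = \<nu>2"
proof (rule extensionalityI[of _ "open_algebra UNIV"])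
  show "\<nu>1 \<in> extensional (open_algebra UNIV)" "\<nu>2 \<in> extensional (open_algebra UNIV)"
    using assms(1,2) by (auto simp: normal_charge_def charge_def PiE_def)
  show "\<nu>1 A = \<nu>2 A" if "A \<in> open_algebra UNIV" for A
    using normal_charge_le[OF assms that] normal_charge_le[OF assms(2,1) assms(3)[symmetric] that]
    by (rule antisym)
qed

text \<open>As \<open>T\<close> is closed, members of \<open>open_algebra T\<close> are members of
  the global algebra. Their closed inner approximations lie in \<open>T\<close> and remain closed
  there.\<close>

lemma normal_charge_closed_subspace:
  assumes \<nu>: "normal_charge UNIV \<nu>" and T: "closed T"
  shows "normal_charge T (restrict \<nu> (open_algebra T))"
proof (rule normal_chargeI)
  have sub: "open_algebra T \<subseteq> open_algebra UNIV"
    using open_algebra_subspace[OF closed_in_open_algebra[OF T]] by blast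
  interpret algebra T "open_algebra T"
    by (rule algebra_open_algebra)
  have charge: "\<nu> \<in> open_algebra UNIV \<rightarrow>\<^sub>E {0..1}" "additive (open_algebra UNIV) \<nu>"
    using \<nu> by (simp_all add: normal_charge_def charge_def)
  show "charge T (restrict \<nu> (open_algebra T))"
    unfolding charge_def
  proof
    show "restrict \<nu> (open_algebra T) \<in> open_algebra T \<rightarrow>\<^sub>E {0..1}"
      by (rule restrict_PiE_iff[THEN iffD2]) (use PiE_mem[OF charge(1)] sub in blast)
    show "additive (open_algebra T) (restrict \<nu> (open_algebra T))"
      unfolding additive_def
    proof (intro ballI impI)
      fix A B assume AB: "A \<in> open_algebra T" "B \<in> open_algebra T" "A \<inter> B = {}"
      then have "\<nu> (A \<union> B) = \<nu> A + \<nu> B"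
        using charge(2) sub unfolding additive_def by blast
      then show "restrict \<nu> (open_algebra T) (A \<union> B) =
          restrict \<nu> (open_algebra T) A + restrict \<nu> (open_algebra T) B"
        using AB Un[OF AB(1,2)] by simp
    qed
  qed
  fix B and e :: real assume B: "B \<in> open_algebra T" and e: "0 < e"
  obtain C where C: "C \<subseteq> B" "closedin (top_of_set UNIV) C" "\<nu> B - e < \<nu> C"
    using normal_charge_inner[OF \<nu> _ e] B sub by blast
  then have "closedin (top_of_set T) C"
    using B sets_into_space[OF B] T by (auto simp: closedin_closed_eq)
  then show "\<exists>C\<subseteq>B. closedin (top_of_set T) C \<and>
      restrict \<nu> (open_algebra T) B - e < restrict \<nu> (open_algebra T) C"
    using B C closedin_in_open_algebra[of T C] by auto
qed

text \<open>The approximation of \<open>A \<inter> S\<close> is closed in the whole space by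
  normality of \<open>\<nu>1\<close>, that of \<open>A \<inter> T\<close> because \<open>T\<close>
  is closed. Their union is closed, and disjointness recovers both parts as its traces.\<close>

lemma normal_charge_glue:
  assumes \<nu>1: "normal_charge UNIV \<nu>1" and S: "S \<in> open_algebra UNIV"
    and \<nu>2: "normal_charge T \<nu>2" and T: "closed T"
    and disj: "S \<inter> T = {}" and le: "\<nu>1 S + \<nu>2 T \<le> 1"
  shows "normal_charge UNIV (\<lambda>A\<in>open_algebra UNIV. \<nu>1 (A \<inter> S) + \<nu>2 (A \<inter> T))"
    (is "normal_charge UNIV ?\<nu>")
proof (rule normal_chargeI)
  interpret \<nu>1: finite_charge UNIV \<nu>1
    using \<nu>1 by (rule finite_charge_of_normal_charge)
  interpret \<nu>2: finite_charge T \<nu>2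
    using \<nu>2 by (rule finite_charge_of_normal_charge)
  have AS: "A \<inter> S \<in> open_algebra UNIV" and AT: "A \<inter> T \<in> open_algebra T" if "A \<in> open_algebra UNIV" for A
    using that S by (auto intro: \<nu>1.Int Int_in_open_algebra)
  show "charge UNIV ?\<nu>"
    unfolding charge_def
  proof
    show "?\<nu> \<in> open_algebra UNIV \<rightarrow>\<^sub>E {0..1}"
    proof (rule PiE_I)
      fix A :: "'a set" assume A: "A \<in> open_algebra UNIV"
      have "\<nu>1 (A \<inter> S) \<le> \<nu>1 S" "\<nu>2 (A \<inter> T) \<le> \<nu>2 T"
        using A S by (auto intro!: \<nu>1.charge_mono \<nu>2.charge_mono AS AT)
      then show "?\<nu> A \<in> {0..1}"
        using A le \<nu>1.nonneg[OF AS[OF A]] \<nu>2.nonneg[OF AT[OF A]] by simp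
    qed simp
    show "additive (open_algebra UNIV) ?\<nu>"
      unfolding additive_def
    proof (intro ballI impI)
      fix A B :: "'a set" assume AB: "A \<in> open_algebra UNIV" "B \<in> open_algebra UNIV" "A \<inter> B = {}"
      have "\<nu>1 ((A \<inter> S) \<union> (B \<inter> S)) = \<nu>1 (A \<inter> S) + \<nu>1 (B \<inter> S)"
        using AB by (intro \<nu>1.Un_disjoint AS) auto
      moreover have "\<nu>2 ((A \<inter> T) \<union> (B \<inter> T)) = \<nu>2 (A \<inter> T) + \<nu>2 (B \<inter> T)"
        using AB by (intro \<nu>2.Un_disjoint AT) auto
      ultimately show "?\<nu> (A \<union> B) = ?\<nu> A + ?\<nu> B"
        using AB \<nu>1.Un[OF AB(1,2)] by (simp add: Int_Un_distrib2)
    qed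
  qed
  fix A :: "'a set" and e :: real assume A: "A \<in> open_algebra UNIV" and "0 < e"
  then have e: "0 < e / 2" by simp
  obtain C where C: "C \<subseteq> A \<inter> S" "closedin (top_of_set UNIV) C" "\<nu>1 (A \<inter> S) - e / 2 < \<nu>1 C"
    by (rule normal_charge_inner[OF \<nu>1 AS[OF A] e])
  obtain D where D: "D \<subseteq> A \<inter> T" "closedin (top_of_set T) D" "\<nu>2 (A \<inter> T) - e / 2 < \<nu>2 D"
    by (rule normal_charge_inner[OF \<nu>2 AT[OF A] e])
  have "closed (C \<union> D)"
    using C(2) D(2) T by (simp add: closedin_closed_eq closed_Un)
  moreover have "(C \<union> D) \<inter> S = C" "(C \<union> D) \<inter> T = D"
    using C(1) D(1) disj by auto
  ultimately show "\<exists>C\<subseteq>A. closedin (top_of_set UNIV) C \<and> ?\<nu> A - e < ?\<nu> C"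
    using A C D closed_in_open_algebra[of "C \<union> D"] by (intro exI[of _ "C \<union> D"]) auto
qed

subsection \<open>Decomposition along regular partitions\<close>

lemma content_charge_le:
  assumes "regular_content \<mu>" "R \<in> regular_opens" "A \<in> open_algebra UNIV" "Q \<in> regular_opens" "A \<subseteq> Q"
  shows "content_charge \<mu> R A \<le> \<mu> (Q \<inter> R)"
proof -
  interpret l: finite_content "\<lambda>Q. \<mu> (Q \<inter> R)"
    using assms(1,2) by (rule finite_content_Int_regular_content)
  show ?thesis
    unfolding content_charge_def l.associated_charge_eq[OF assms(3)]
    using assms(4,5) by (rule l.inner_mass_le_content)
qed

lemma content_charge_closed_ge:
  assumes "regular_content \<mu>" "R \<in> regular_opens" "closed C"
    and "\<And>Q. \<lbrakk>Q \<in> regular_opens; C \<subseteq> Q\<rbrakk> \<Longrightarrow> x \<le> \<mu> (Q \<inter> R)"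
  shows "x \<le> content_charge \<mu> R C"
proof -
  interpret l: finite_content "\<lambda>Q. \<mu> (Q \<inter> R)"
    using assms(1,2) by (rule finite_content_Int_regular_content)
  show ?thesis
    unfolding content_charge_def l.associated_charge_eq[OF closed_in_open_algebra[OF assms(3)]]
      l.inner_mass_closed[OF assms(3)]
    using assms(4) by (rule l.outer_mass_greatest)
qed

lemma content_charge_UNIV:
  assumes "regular_content \<mu>" "R \<in> regular_opens"
  shows "content_charge \<mu> R UNIV = \<mu> R"
proof -
  interpret l: finite_content "\<lambda>Q. \<mu> (Q \<inter> R)"
    using assms by (rule finite_content_Int_regular_content)
  show ?thesis
    unfolding content_charge_def
    by (simp add: l.associated_charge_eq l.inner_mass_UNIV open_in_open_algebra)
qed

text \<open>The regular set \<open>- closure R\<close> covers \<open>A\<close> and does not meet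
  \<open>R\<close>.\<close>

lemma content_charge_eq_0:
  assumes "regular_content \<mu>" "R \<in> regular_opens" "A \<in> open_algebra UNIV" "A \<inter> closure R = {}"
  shows "content_charge \<mu> R A = 0"
proof (rule antisym)
  have "(- closure R) \<inter> R = {}"
    using closure_subset by blast
  then have "\<mu> ((- closure R) \<inter> R) = 0"
    using finite_content.empty[OF finite_content_regular_content[OF assms(1)]] by simp
  moreover have "content_charge \<mu> R A \<le> \<mu> ((- closure R) \<inter> R)"
    using assms by (intro content_charge_le Compl_closure_in_regular_opens) auto
  ultimately show "content_charge \<mu> R A \<le> 0"
    by linarith
  show "0 \<le> content_charge \<mu> R A"
    using finite_charge.nonneg[OF finite_charge_of_normal_charge[OF normal_charge_content_charge] assms(3)]
      assms(1,2) by blast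
qed

text \<open>
  Both sides are additive with total mass 1, so one inequality for all sets, applied to a set
  and to its complement, suffices.
\<close>

lemma sum_content_charge:
  fixes \<mu> :: "'a::t4_space set \<Rightarrow> real"
  assumes \<mu>: "regular_content \<mu>" and P: "regular_partition P" and A: "A \<in> open_algebra UNIV"
  shows "(\<Sum>R\<in>P. content_charge \<mu> R A) = content_charge \<mu> UNIV A"
proof -
  let ?\<nu> = "content_charge \<mu>"
  have fin: "finite P" and P_regular: "R \<in> P \<Longrightarrow> R \<in> regular_opens" for R
    using P unfolding regular_partition_def by blast+
  have charge: "finite_charge UNIV (?\<nu> R)" if "R \<in> regular_opens" for R
    by (rule finite_charge_of_normal_charge[OF normal_charge_content_charge[OF \<mu> that]])
  have closed: "(\<Sum>R\<in>P. ?\<nu> R C) \<le> ?\<nu> UNIV C" if C: "closed C" for C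
  proof (rule content_charge_closed_ge[OF \<mu> UNIV_in_regular_opens C])
    fix Q assume Q: "Q \<in> regular_opens" "C \<subseteq> Q"
    have "(\<Sum>R\<in>P. ?\<nu> R C) \<le> (\<Sum>R\<in>P. \<mu> (R \<inter> Q))"
      using content_charge_le[OF \<mu> P_regular closed_in_open_algebra[OF C] Q]
      by (auto intro!: sum_mono simp: Int_commute)
    then show "(\<Sum>R\<in>P. ?\<nu> R C) \<le> \<mu> (Q \<inter> UNIV)"
      using sum_regular_partition[OF \<mu> P Q(1)] by simp
  qed
  have le: "(\<Sum>R\<in>P. ?\<nu> R A) \<le> ?\<nu> UNIV A" if A: "A \<in> open_algebra UNIV" for A
  proof (rule field_le_epsilon)
    fix e :: real assume "0 < e"
    \<comment> \<open>The tolerance is shared among the cells; the successor keeps the divisor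
      positive.\<close>
    define d where "d = e / real (Suc (card P))"
    have d: "0 < d" "real (card P) * d \<le> e"
      using \<open>0 < e\<close> by (auto simp: d_def field_simps)
    have "\<exists>C\<subseteq>A. closed C \<and> ?\<nu> R A - d < ?\<nu> R C" if "R \<in> P" for R
      using normal_charge_inner[OF normal_charge_content_charge[OF \<mu> P_regular[OF that]] A d(1)]
      by (metis closed_closedin subtopology_UNIV)
    then obtain C where C: "\<And>R. R \<in> P \<Longrightarrow> C R \<subseteq> A \<and> closed (C R) \<and> ?\<nu> R A - d < ?\<nu> R (C R)"
      by metis
    \<comment> \<open>One closed set has to serve all cells at once; the finite union of their
      approximations does.\<close>
    let ?C = "\<Union>R\<in>P. C R"
    have C_closed: "closed ?C"
      using fin C by blast
    have "?\<nu> R A \<le> ?\<nu> R ?C + d" if "R \<in> P" for R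
    proof -
      have "?\<nu> R (C R) \<le> ?\<nu> R ?C"
        using C[OF that] that by (intro finite_charge.charge_mono[OF charge[OF P_regular[OF that]]
              closed_in_open_algebra[OF C_closed] closed_in_open_algebra]) blast+
      then show ?thesis
        using C[OF that] by linarith
    qed
    then have "(\<Sum>R\<in>P. ?\<nu> R A) \<le> (\<Sum>R\<in>P. ?\<nu> R ?C + d)"
      by (rule sum_mono)
    also have "\<dots> = (\<Sum>R\<in>P. ?\<nu> R ?C) + real (card P) * d"
      by (simp add: sum.distrib)
    also have "\<dots> \<le> ?\<nu> UNIV ?C + e"
      using closed[OF C_closed] d(2) by linarith
    also have "?\<nu> UNIV ?C \<le> ?\<nu> UNIV A"
      using C by (intro finite_charge.charge_mono[OF charge[OF UNIV_in_regular_opens] A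
            closed_in_open_algebra[OF C_closed]]) blast
    finally show "(\<Sum>R\<in>P. ?\<nu> R A) \<le> ?\<nu> UNIV A + e"
      by linarith
  qed
  interpret U: finite_charge UNIV "?\<nu> UNIV"
    by (rule charge) simp
  have compl: "UNIV - A \<in> open_algebra UNIV"
    using A by (rule U.compl_sets)
  have total: "?\<nu> R (UNIV - A) = \<mu> R - ?\<nu> R A" if "R \<in> regular_opens" for R
    using finite_charge.charge_Diff[OF charge[OF that] U.top A] content_charge_UNIV[OF \<mu> that] by simp
  have "(\<Sum>R\<in>P. ?\<nu> R (UNIV - A)) = (\<Sum>R\<in>P. \<mu> R) - (\<Sum>R\<in>P. ?\<nu> R A)"
    using total P_regular by (simp add: sum_subtractf)
  moreover have "(\<Sum>R\<in>P. \<mu> R) = \<mu> UNIV"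
    using sum_regular_partition[OF \<mu> P UNIV_in_regular_opens] by simp
  ultimately show ?thesis
    using le[OF A] le[OF compl] total[OF UNIV_in_regular_opens] by linarith
qed

lemma regular_partition_complement:
  assumes "R \<in> regular_opens"
  shows "regular_partition {R, - closure R}"
  unfolding regular_partition_def
proof (intro conjI)
  have "R \<inter> - closure R = {}"
    using closure_subset by blast
  then show "disjoint {R, - closure R}"
    by (auto simp: disjoint_def)
  have "closure (R \<union> - closure R) = UNIV"
    unfolding closure_Un closure_Compl_closure[OF assms] using closure_subset by blast
  then show "regular_Join {R, - closure R} = UNIV"
    by (simp add: regular_Join_def del: closure_Un)
qed (use assms Compl_closure_in_regular_opens in auto)

lemma content_charge_complement:
  fixes \<mu> :: "'a::t4_space set \<Rightarrow> real"
  assumes \<mu>: "regular_content \<mu>" and R: "R \<in> regular_opens" and A: "A \<in> open_algebra UNIV"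
  shows "content_charge \<mu> UNIV A = content_charge \<mu> R A + content_charge \<mu> (- closure R) A"
proof -
  \<comment> \<open>The sum over the two cells must not collapse to a single term.\<close>
  have "R \<noteq> - closure R"
  proof
    assume "R = - closure R"
    then have "R = {}"
      using closure_subset[of R] by blast
    then show False
      using \<open>R = - closure R\<close> by auto
  qed
  then show ?thesis
    using sum_content_charge[OF \<mu> regular_partition_complement[OF R] A] by simp
qed

text \<open>This domination yields the absolute continuity of the liminal charges.\<close>

lemma content_charge_le_UNIV:
  assumes "regular_content \<mu>" "R \<in> regular_opens" "A \<in> open_algebra UNIV"
  shows "content_charge \<mu> R A \<le> content_charge \<mu> UNIV A"
  using content_charge_complement[OF assms] finite_charge.nonneg[OF finite_charge_of_normal_charge[OF
      normal_charge_content_charge[OF assms(1) Compl_closure_in_regular_opens[OF assms(2)]]] assms(3)]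
  by linarith

text \<open>The charge of \<open>R\<close> vanishes off \<open>closure R\<close>. On
  \<open>R\<close> the charge of the complement \<open>- closure R\<close> vanishes, since that set
  has closure \<open>- R\<close>, so there the charge of \<open>R\<close> is the full one.\<close>

lemma content_charge_split:
  fixes \<mu> :: "'a::t4_space set \<Rightarrow> real"
  assumes \<mu>: "regular_content \<mu>" and R: "R \<in> regular_opens" and A: "A \<in> open_algebra UNIV"
  shows "content_charge \<mu> R A = content_charge \<mu> UNIV (A \<inter> R) + content_charge \<mu> R (A \<inter> frontier R)"
proof -
  interpret finite_charge UNIV "content_charge \<mu> R"
    by (rule finite_charge_of_normal_charge[OF normal_charge_content_charge[OF \<mu> R]])
  have sets: "A \<inter> R \<in> open_algebra UNIV" "A \<inter> frontier R \<in> open_algebra UNIV" "A - closure R \<in> open_algebra UNIV"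
    by (intro Int Diff A open_in_open_algebra closed_in_open_algebra regular_opens_open[OF R]
        closed_closure frontier_closed)+
  have front: "frontier R = closure R - R"
    using R by (simp add: frontier_def interior_open regular_opens_open)
  have "A = (A \<inter> R \<union> A \<inter> frontier R) \<union> (A - closure R)"
    using closure_subset by (auto simp: front)
  then have "content_charge \<mu> R A =
      content_charge \<mu> R ((A \<inter> R \<union> A \<inter> frontier R) \<union> (A - closure R))"
    by (rule arg_cong)
  also have "\<dots> = content_charge \<mu> R (A \<inter> R \<union> A \<inter> frontier R) + content_charge \<mu> R (A - closure R)"
    using closure_subset by (intro Un_disjoint Un sets) (auto simp: front)
  also have "content_charge \<mu> R (A - closure R) = 0"
    by (rule content_charge_eq_0[OF \<mu> R sets(3)]) auto
  also have "content_charge \<mu> R (A \<inter> R \<union> A \<inter> frontier R)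
      = content_charge \<mu> R (A \<inter> R) + content_charge \<mu> R (A \<inter> frontier R)"
    by (intro Un_disjoint sets) (auto simp: front)
  also have "content_charge \<mu> R (A \<inter> R) = content_charge \<mu> UNIV (A \<inter> R)"
  proof -
    have "content_charge \<mu> (- closure R) (A \<inter> R) = 0"
      by (rule content_charge_eq_0[OF \<mu> Compl_closure_in_regular_opens[OF R] sets(1)])
        (auto simp: closure_Compl_closure[OF R])
    then show ?thesis
      using content_charge_complement[OF \<mu> R sets(1)] by simp
  qed
  finally show ?thesis by simp
qed

section \<open>Existence and uniqueness of the charge and of its liminal structure\<close>

theorem theorem6p4:
  fixes \<mu> :: "'a::t4_space set \<Rightarrow> real"
  assumes "regular_content \<mu>"
  shows "\<exists>\<nu>. (probability_charge UNIV \<nu> \<and> normal_charge UNIV \<nu> \<and>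
              (\<forall>f\<in>bcontfun. content_integral UNIV \<mu> f = charge_integral UNIV \<nu> f)) \<and>
             (\<forall>\<nu>'. probability_charge UNIV \<nu>' \<and> normal_charge UNIV \<nu>' \<and>
              (\<forall>f\<in>bcontfun. content_integral UNIV \<mu> f = charge_integral UNIV \<nu>' f) \<longrightarrow> \<nu>' = \<nu>) \<and>
             (\<exists>!\<rho>. normal_liminal_charge_structure \<nu> \<rho> \<and>
              (\<forall>R\<in>regular_opens.
                 \<mu> R = \<nu> R + \<rho> R (frontier R) \<and>
                 (\<forall>f\<in>bcontfun.
                    content_integral R \<mu> f =
                    charge_integral R \<nu> f + charge_integral (frontier R) (\<rho> R) f)))"
proof -
  let ?\<nu> = "content_charge \<mu>"
  let ?\<nu>S = "content_charge \<mu> UNIV"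
  note \<mu> = assms
  have normal: "normal_charge UNIV (?\<nu> R)" if "R \<in> regular_opens" for R
    by (rule normal_charge_content_charge[OF \<mu> that])
  note finite = finite_charge_of_normal_charge[OF normal]
  have normal_S: "normal_charge UNIV ?\<nu>S" and finite_S: "finite_charge UNIV ?\<nu>S"
    by (simp_all add: normal finite)
  have integral_S: "content_integral UNIV \<mu> f = charge_integral UNIV ?\<nu>S f" if "f \<in> bcontfun" for f
    by (rule content_integral_eq_charge_integral[OF \<mu> UNIV_in_regular_opens that])
  have "?\<nu>S UNIV = 1"
    using content_charge_UNIV[OF \<mu> UNIV_in_regular_opens] \<mu> by (simp add: regular_content_def)
  then have prob_S: "probability_charge UNIV ?\<nu>S"
    using normal_S unfolding probability_charge_def normal_charge_def by blast
  have unique_S: "\<nu>' = ?\<nu>S"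
    if "normal_charge UNIV \<nu>'" "\<forall>f\<in>bcontfun. content_integral UNIV \<mu> f = charge_integral UNIV \<nu>' f" for \<nu>'
    using that integral_S by (intro normal_charge_unique normal_S) auto

  define represents where "represents \<rho> R \<longleftrightarrow>
      \<mu> R = ?\<nu>S R + \<rho> R (frontier R) \<and>
      (\<forall>f\<in>bcontfun. content_integral R \<mu> f =
         charge_integral R ?\<nu>S f + charge_integral (frontier R) (\<rho> R) f)"
    for \<rho> :: "'a set \<Rightarrow> 'a set \<Rightarrow> real" and R
  have sets: "R \<in> open_algebra UNIV" "frontier R \<in> open_algebra UNIV" if "R \<in> regular_opens" for R :: "'a set"
    using that by (simp_all add: open_in_open_algebra closed_in_open_algebra regular_opens_open frontier_closed)
  have sub: "open_algebra (frontier R) \<subseteq> open_algebra UNIV" if "R \<in> regular_opens" for R :: "'a set"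
    using open_algebra_subspace[OF sets(2)[OF that]] by blast
  have disj: "R \<inter> frontier R = {}" if "R \<in> regular_opens" for R :: "'a set"
    using that by (auto simp: frontier_def interior_open regular_opens_open)

  \<comment> \<open>Restricted twice, because extensionality is demanded both in \<open>R\<close>
    and in the subset of its frontier.\<close>
  define \<rho> where "\<rho> = (\<lambda>R\<in>regular_opens. restrict (?\<nu> R) (open_algebra (frontier R)))"
  have \<rho>: "\<rho> R U = ?\<nu> R U" if "R \<in> regular_opens" "U \<in> open_algebra (frontier R)" for R U
    using that by (simp add: \<rho>_def)
  have split: "?\<nu> R A = ?\<nu>S (A \<inter> R) + \<rho> R (A \<inter> frontier R)"
    if "R \<in> regular_opens" "A \<in> open_algebra UNIV" for R A
    using content_charge_split[OF \<mu> that] \<rho>[OF that(1) Int_in_open_algebra[OF that(2)]] by simp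
  have normal_\<rho>: "normal_charge (frontier R) (\<rho> R)" if "R \<in> regular_opens" for R
    using normal_charge_closed_subspace[OF normal[OF that] frontier_closed] that by (simp add: \<rho>_def)

  have represents_\<rho>: "represents \<rho> R" if R: "R \<in> regular_opens" for R
  proof -
    have "\<mu> R = ?\<nu>S R + \<rho> R (frontier R)"
      using split[OF R, of UNIV] content_charge_UNIV[OF \<mu> R] by (simp add: open_in_open_algebra)
    moreover have "content_integral R \<mu> f = charge_integral R ?\<nu>S f + charge_integral (frontier R) (\<rho> R) f"
      if "f \<in> bcontfun" for f
      unfolding content_integral_eq_charge_integral[OF \<mu> R that]
      by (rule charge_integral_glue[OF finite[OF R] finite_charge_subspace[OF finite_S sets(1)[OF R]]
            finite_charge_of_normal_charge[OF normal_\<rho>[OF R]] split[OF R] that])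
    ultimately show ?thesis
      unfolding represents_def by blast
  qed

  have "liminal_charge_structure ?\<nu>S \<rho>"
    unfolding liminal_charge_structure_def
  proof (intro conjI ballI allI impI)
    show "\<rho> \<in> extensional regular_opens"
      by (simp add: \<rho>_def)
    fix R :: "'a set" assume R: "R \<in> regular_opens"
    show "charge (frontier R) (\<rho> R)"
      using normal_\<rho>[OF R] unfolding normal_charge_def by blast
    fix U assume U: "U \<in> open_algebra (frontier R)" "?\<nu>S U = 0"
    then have "?\<nu> R U \<le> 0" "0 \<le> ?\<nu> R U"
      using content_charge_le_UNIV[OF \<mu> R, of U] finite_charge.nonneg[OF finite[OF R]] sub[OF R] by auto
    then show "\<rho> R U = 0"
      using \<rho>[OF R U(1)] by linarith
  next
    fix P :: "'a set set" and U
    assume P: "regular_partition P" and U: "U \<in> open_algebra (\<Union>R\<in>P. frontier R)"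
    have P_regular: "R \<in> regular_opens" if "R \<in> P" for R
      using P that unfolding regular_partition_def by blast
    \<comment> \<open>No cell meets the frontier of any cell. Hence \<open>U\<close>, lying in the
      union of the frontiers, misses every cell \<open>R\<close>, and \<open>split\<close> gives it
      the whole mass \<open>?\<nu> R U\<close> on the frontier of \<open>R\<close>.\<close>
    have P_disj: "R \<inter> frontier S = {}" if "R \<in> P" "S \<in> P" for R S
    proof (cases "R = S")
      case True
      then show ?thesis
        using disj[OF P_regular[OF that(1)]] by simp
    next
      case False
      then have "R \<inter> S = {}"
        using P that unfolding regular_partition_def disjoint_def by blast
      then have "R \<inter> closure S = {}"
        using open_Int_closure_eq_empty[OF regular_opens_open[OF P_regular[OF that(1)]]] by blast
      then show ?thesis
        by (auto simp: frontier_def)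
    qed
    have "finite P"
      using P by (simp add: regular_partition_def)
    then have "(\<Union>R\<in>P. frontier R) \<in> open_algebra UNIV"
      by (intro closed_in_open_algebra closed_UN) (auto simp: frontier_closed)
    then have U': "U \<in> open_algebra UNIV" "U \<subseteq> (\<Union>R\<in>P. frontier R)"
      using U open_algebra_subspace by blast+
    have "\<rho> R (U \<inter> frontier R) = ?\<nu> R U" if R: "R \<in> P" for R
    proof -
      have "U \<inter> R = {}"
        using U'(2) P_disj[OF R] by blast
      then show ?thesis
        using split[OF P_regular[OF R] U'(1)] finite_charge.charge_empty[OF finite_S] by simp
    qed
    then show "(\<Sum>R\<in>P. \<rho> R (U \<inter> frontier R)) = ?\<nu>S U"
      using sum_content_charge[OF \<mu> P U'(1)] by simp
  qed
  then have structure_\<rho>: "normal_liminal_charge_structure ?\<nu>S \<rho>"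
    using normal_\<rho> by (simp add: normal_liminal_charge_structure_def)

  have unique_\<rho>: "\<rho>' = \<rho>"
    if liminal: "normal_liminal_charge_structure ?\<nu>S \<rho>'"
      and represents: "\<And>R. R \<in> regular_opens \<Longrightarrow> represents \<rho>' R" for \<rho>'
  proof (rule extensionalityI[of _ regular_opens])
    show "\<rho>' \<in> extensional regular_opens" "\<rho> \<in> extensional regular_opens"
      using liminal
      by (simp_all add: \<rho>_def normal_liminal_charge_structure_def liminal_charge_structure_def)
    fix R :: "'a set" assume R: "R \<in> regular_opens"
    have normal': "normal_charge (frontier R) (\<rho>' R)"
      using liminal R unfolding normal_liminal_charge_structure_def by blast
    \<comment> \<open>The competitor \<open>\<rho>' R\<close> is glued to the full charge on
      \<open>R\<close>. The result is normal and has the same integrals as \<open>?\<nu> R\<close>,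
      so it equals \<open>?\<nu> R\<close>.\<close>
    let ?g = "\<lambda>A\<in>open_algebra UNIV. ?\<nu>S (A \<inter> R) + \<rho>' R (A \<inter> frontier R)"
    have \<mu>R: "\<mu> R = ?\<nu>S R + \<rho>' R (frontier R)"
      using represents[OF R] by (simp add: represents_def)
    \<comment> \<open>Gluing requires total mass at most 1; the first identity in
      \<open>represents\<close> turns that into a bound on \<open>\<mu> R\<close>.\<close>
    have "\<mu> R \<le> \<mu> UNIV"
      using finite_content.mono[OF finite_content_regular_content[OF \<mu>]] R by simp
    then have "?\<nu>S R + \<rho>' R (frontier R) \<le> 1"
      using \<mu>R \<mu> by (simp add: regular_content_def)
    then have normal_g: "normal_charge UNIV ?g"
      by (rule normal_charge_glue[OF normal_S sets(1)[OF R] normal' frontier_closed disj[OF R]])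
    have "?g = ?\<nu> R"
    proof (rule normal_charge_unique[OF normal_g normal[OF R]])
      fix f :: "'a \<Rightarrow> real" assume f: "f \<in> bcontfun"
      have "charge_integral UNIV ?g f = charge_integral R ?\<nu>S f + charge_integral (frontier R) (\<rho>' R) f"
        by (rule charge_integral_glue[OF finite_charge_of_normal_charge[OF normal_g]
              finite_charge_subspace[OF finite_S sets(1)[OF R]]
              finite_charge_of_normal_charge[OF normal'] _ f]) simp
      also have "\<dots> = content_integral R \<mu> f"
        using represents[OF R] f by (simp add: represents_def)
      also have "\<dots> = charge_integral UNIV (?\<nu> R) f"
        by (rule content_integral_eq_charge_integral[OF \<mu> R f])
      finally show "charge_integral UNIV ?g f = charge_integral UNIV (?\<nu> R) f" .
    qed
    show "\<rho>' R = \<rho> R"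
    proof (rule extensionalityI[of _ "open_algebra (frontier R)"])
      show "\<rho>' R \<in> extensional (open_algebra (frontier R))" "\<rho> R \<in> extensional (open_algebra (frontier R))"
        using normal' normal_\<rho>[OF R] unfolding normal_charge_def charge_def PiE_def by blast+
      fix U assume U: "U \<in> open_algebra (frontier R)"
      then have U': "U \<in> open_algebra UNIV" "U \<inter> R = {}" "U \<inter> frontier R = U"
        using sub[OF R] disj[OF R] open_algebra_subspace[OF sets(2)[OF R]] by blast+
      have "\<rho>' R U = ?g U"
        using U' finite_charge.charge_empty[OF finite_S] by simp
      also have "\<dots> = \<rho> R U"
        using \<open>?g = ?\<nu> R\<close> \<rho>[OF R U] by metis
      finally show "\<rho>' R U = \<rho> R U" .
    qed
  qed

  have "\<exists>!\<rho>. normal_liminal_charge_structure ?\<nu>S \<rho> \<and> (\<forall>R\<in>regular_opens. represents \<rho> R)"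
    using structure_\<rho> represents_\<rho> unique_\<rho> by (intro ex1I[of _ \<rho>]) blast+
  note liminal = this[unfolded represents_def]
  show ?thesis
    by (rule exI[of _ ?\<nu>S], intro conjI liminal)
      (use prob_S normal_S integral_S unique_S in blast)+
qed

end
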